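(* Let $\mathbb F$ be a field of characteristic $p\ge3$, let $L$ and $M$ be restricted Lie algebras over $\mathbb F$ and let $\varphi:L\to M$ be a restricted morphism. Then the maps $\mathfrak d^0_*,\mathfrak d^1_*,\mathfrak d^2_*$ of the restricted deformation complex of $\varphi$ satisfy $\mathfrak d^2_*\circ\mathfrak d^1_*=0$ and $\mathfrak d^1_*\circ\mathfrak d^0_*=0$. Therefore the quotient spaces $\mathfrak H^n_*(\varphi,\varphi):=\mathfrak Z^n_*(\varphi,\varphi)/\mathfrak B^n_*(\varphi,\varphi)$, where $\mathfrak Z^n_*(\varphi,\varphi)=\ker\mathfrak d^n_*$ and $\mathfrak B^n_*(\varphi,\varphi)=\mathrm{Im}\,\mathfrak d^{n-1}_*$, are well defined for $n\in\{1,2\}$.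
   Context: Restricted Lie algebra over a field $\mathbb F$ of characteristic $p$: a Lie algebra $L$ with a map $(\cdot)^{[p]}:L\to L$ such that $(\lambda x)^{[p]}=\lambda^p x^{[p]}$; $[x,y^{[p]}]=[[\cdots[x,y],y],\cdots,y]$ ($p$ copies of $y$); $(x+y)^{[p]}=x^{[p]}+y^{[p]}+\sum_{i=1}^{p-1}s_i(x,y)$, where $i\,s_i(x,y)$ is the coefficient of $Z^{i-1}$ in $\mathrm{ad}^{p-1}_{Zx+y}(x)$. A restricted morphism is a Lie morphism $\varphi$ with $\varphi(x^{[p]})=\varphi(x)^{[p]}$. An $L$-module $V$ is restricted if $x^{[p]}\cdot m=x\cdot(x\cdots(x\cdot m))$ ($p$ times). $L$ and $M$ act on themselves by the adjoint action; $M$ is a restricted $L$-module via $x\cdot m=[\varphi(x),m]_M$. For a restricted Lie algebra $L$ and a restricted $L$-module $V$: $C^n_{CE}(L,V)$ is the space of alternating $n$-linear maps $L^n\to V$ (with $C^0_{CE}(L,V)=V$), with Chevalley–Eilenberg differentials $d^0_{CE}m(x)=x\cdot m$, $d^1_{CE}\psi(x,y)=-\psi([x,y])+x\cdot\psi(y)-y\cdot\psi(x)$, $d^2_{CE}\psi(x,y,z)=-\psi([x,y],z)+\psi([x,z],y)-\psi([y,z],x)+x\cdot\psi(y,z)-y\cdot\psi(x,z)+z\cdot\psi(x,y)$. Put $C^0_*(L,V)=C^0_{CE}(L,V)$ and $C^1_*(L,V)=C^1_{CE}(L,V)$. $C^2_*(L,V)$ is the set of pairs $(\psi,\omega)$ with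 $\psi\in C^2_{CE}(L,V)$ and $\omega:L\to V$ a map with the $( * )$-property with respect to $\psi$: $\omega(\lambda x)=\lambda^p\omega(x)$ and $$\omega(x+y)=\omega(x)+\omega(y)+\sum_{\substack{x_i\in\{x,y\}\\ x_1=x,\ x_2=y}}\frac1{\sharp\{x\}}\sum_{k=0}^{p-2}(-1)^k\,x_p\cdots x_{p-k+1}\,\psi([[\cdots[x_1,x_2],x_3]\cdots,x_{p-k-1}],x_{p-k}),$$ where the outer sum is over $p$-tuples $(x_1,\dots,x_p)$ of symbols in $\{x,y\}$ with $x_1=x$, $x_2=y$, and $\sharp\{x\}$ is the number of $x_i$ equal to $x$. $C^3_*(L,V)$ is the set of pairs $(\alpha,\beta)$ with $\alpha\in C^3_{CE}(L,V)$ and $\beta:L\times L\to V$ a map with the $( ** )$-property with respect to $\alpha$: $\beta(x,y)$ is linear in $x$; $\beta(x,\lambda y)=\lambda^p\beta(x,y)$; and $$\beta(x,y_1+y_2)=\beta(x,y_1)+\beta(x,y_2)-\sum_{\substack{h_i\in\{y_1,y_2\}\\ h_1=y_1,\ h_2=y_2}}\frac1{\sharp\{y_1\}}\sum_{j=0}^{p-2}(-1)^j\sum_{k=0}^{j}\binom jk h_p\cdots h_{p-k+1}\,\alpha\big([\cdots[x,h_{p-k}],\cdots,h_{p-j+1}],[\cdots[h_1,h_2],\cdots,h_{p-j-1}],h_{p-j}\big),$$ where the outer sum is over $p$-tuples $(h_1,\dots,h_p)$ of symbols in $\{y_1,y_2\}$ with $h_1=y_1$, $h_2=y_2$, and $\sharp\{y_1\}$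 is the number of $h_i$ equal to $y_1$. For $\psi\in C^1_*(L,V)$: $\mathrm{ind}^1(\psi)(x)=-\psi(x^{[p]})+x^{p-1}\cdot\psi(x)$. For $(\alpha,\beta)\in C^2_*(L,V)$: $\mathrm{ind}^2(\alpha,\beta)(x,y)=-\alpha(x,y^{[p]})+\sum_{i+j=p-1}(-1)^iy^i\cdot\alpha([\cdots[x,\underbrace{y],\cdots,y}_{j}],y)-x\cdot\beta(y)$. It is known (Evans–Fuchs) that $\mathrm{ind}^1(\psi)$ has the $( * )$-property with respect to $d^1_{CE}\psi$ and that $\mathrm{ind}^2(\alpha,\beta)$ has the $( ** )$-property with respect to $d^2_{CE}\alpha$. Let $\widetilde C^2_*(L,M)$ be the set of pairs $(\psi,\omega)$ with $\psi\in C^2_{CE}(L,M)$ and $\omega:L\to M$ a $p$-homogeneous map, i.e. $\omega(\lambda x)=\lambda^p\omega(x)$. Restricted deformation complex of $\varphi$: $\mathfrak C^0_*(\varphi,\varphi)=0$, $\mathfrak C^1_*(\varphi,\varphi)=C^1_*(L,L)\times C^1_*(M,M)\times C^0_*(L,M)$, $\mathfrak C^2_*(\varphi,\varphi)=C^2_*(L,L)\times C^2_*(M,M)\times C^1_*(L,M)$, $\mathfrak C^3_*(\varphi,\varphi)=C^3_*(L,L)\times C^3_*(M,M)\times\widetilde C^2_*(L,M)$. The differentials $\mathfrak d^n_*:\mathfrak C^n_*(\varphi,\varphi)\to\mathfrak C^{n+1}_*(\varphi,\varphi)$, $n=0,1,2$, are: $\mathfrak d^0_*$ the zero map (the only linear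 map on $\mathfrak C^0_*(\varphi,\varphi)=0$), $$\mathfrak d^1_*(\gamma,\tau,m)=\big((d^1_{CE}\gamma,\mathrm{ind}^1(\gamma)),\ (d^1_{CE}\tau,\mathrm{ind}^1(\tau)),\ \varphi\circ\gamma-\tau\circ\varphi-d^0_{CE}m\big),$$ $$\mathfrak d^2_*\big((\mu,\omega),(\nu,\epsilon),\theta\big)=\big((d^2_{CE}\mu,\mathrm{ind}^2(\mu,\omega)),\ (d^2_{CE}\nu,\mathrm{ind}^2(\nu,\epsilon)),\ (\alpha_{\mu,\nu}(\theta),\beta_{\omega,\epsilon}(\theta))\big),$$ with $\alpha_{\mu,\nu}(\theta)=\varphi\circ\mu-\nu\circ(\varphi\otimes\varphi)-d^1_{CE}\theta$ and $\beta_{\omega,\epsilon}(\theta)(x)=\theta(x^{[p]})+\varphi(\omega(x))-\epsilon(\varphi(x))-x^{p-1}\cdot\theta(x)$ for $x\in L$. *)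

theory Defs
  imports
    "HOL-Computational_Algebra.Polynomial"
    "HOL-Library.FuncSet"
    "HOL-Library.Function_Algebras"
    "HOL-Library.Product_Plus"
begin

text \<open>
  The underlying vector space of a Lie algebra is a whole type, with explicit scalar
  multiplication \<open>scal\<close>; the characteristic \<open>p\<close> is \<open>CHAR('f)\<close> throughout.
  Sums and zeros of cochains are those of the pointwise group structure on functions and pairs.
\<close>

section \<open>Restricted Lie algebras, morphisms and modules\<close>

record ('f, 'a) restricted_lie =
  scal :: "'f \<Rightarrow> 'a \<Rightarrow> 'a"
  brk :: "'a \<Rightarrow> 'a \<Rightarrow> 'a"
  pmap :: "'a \<Rightarrow> 'a"

definition lie_algebra :: "('f::field, 'a::ab_group_add) restricted_lie \<Rightarrow> bool" where
  "lie_algebra L \<longleftrightarrow>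
     vector_space (scal L) \<and>
     (\<forall>x. Vector_Spaces.linear (scal L) (scal L) (\<lambda>y. brk L x y)) \<and>
     (\<forall>y. Vector_Spaces.linear (scal L) (scal L) (\<lambda>x. brk L x y)) \<and>
     (\<forall>x. brk L x x = 0) \<and>
     (\<forall>x y z. brk L x (brk L y z) + brk L y (brk L z x) + brk L z (brk L x y) = 0)"

text \<open>\<open>ad_line L x y\<close> is \<open>ad\<close> of \<open>Z x + y\<close> acting on polynomials in \<open>Z\<close> with coefficients in \<open>L\<close>.\<close>

definition ad_line :: "('f, 'a::ab_group_add) restricted_lie \<Rightarrow> 'a \<Rightarrow> 'a \<Rightarrow> 'a poly \<Rightarrow> 'a poly" where
  "ad_line L x y q = pCons 0 (map_poly (brk L x) q) + map_poly (brk L y) q"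

definition jacobson_s :: "('f::field, 'a::ab_group_add) restricted_lie \<Rightarrow> nat \<Rightarrow> 'a \<Rightarrow> 'a \<Rightarrow> 'a" where
  "jacobson_s L i x y =
     scal L (inverse (of_nat i)) (coeff ((ad_line L x y ^^ (CHAR('f) - 1)) [:x:]) (i - 1))"

definition restricted_lie_algebra :: "('f::field, 'a::ab_group_add) restricted_lie \<Rightarrow> bool" where
  "restricted_lie_algebra L \<longleftrightarrow>
     CHAR('f) > 0 \<and> lie_algebra L \<and>
     (\<forall>c x. pmap L (scal L c x) = scal L (c ^ CHAR('f)) (pmap L x)) \<and>
     (\<forall>x y. brk L x (pmap L y) = ((\<lambda>u. brk L u y) ^^ CHAR('f)) x) \<and>
     (\<forall>x y. pmap L (x + y) = pmap L x + pmap L y + (\<Sum>i = 1..CHAR('f) - 1. jacobson_s L i x y))"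

definition restricted_morphism ::
  "('f::field, 'a::ab_group_add) restricted_lie \<Rightarrow> ('f, 'b::ab_group_add) restricted_lie \<Rightarrow> ('a \<Rightarrow> 'b) \<Rightarrow> bool"
where
  "restricted_morphism L M \<phi> \<longleftrightarrow>
     Vector_Spaces.linear (scal L) (scal M) \<phi> \<and>
     (\<forall>x y. \<phi> (brk L x y) = brk M (\<phi> x) (\<phi> y)) \<and>
     (\<forall>x. \<phi> (pmap L x) = pmap M (\<phi> x))"

text \<open>A module \<open>V\<close> is given by its scalar multiplication \<open>s\<close> and its action \<open>act\<close>.\<close>

definition restricted_module ::
  "('f::field, 'a::ab_group_add) restricted_lie \<Rightarrow> ('f \<Rightarrow> 'v::ab_group_add \<Rightarrow> 'v) \<Rightarrow> ('a \<Rightarrow> 'v \<Rightarrow> 'v) \<Rightarrow> bool"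
where
  "restricted_module L s act \<longleftrightarrow>
     vector_space s \<and>
     (\<forall>x. Vector_Spaces.linear s s (\<lambda>v. act x v)) \<and>
     (\<forall>v. Vector_Spaces.linear (scal L) s (\<lambda>x. act x v)) \<and>
     (\<forall>x y v. act (brk L x y) v = act x (act y v) - act y (act x v)) \<and>
     (\<forall>x v. act (pmap L x) v = (act x ^^ CHAR('f)) v)"

section \<open>Chevalley--Eilenberg cochains\<close>

definition CE1 :: "('f::field, 'a::ab_group_add) restricted_lie \<Rightarrow> ('f \<Rightarrow> 'v::ab_group_add \<Rightarrow> 'v) \<Rightarrow> ('a \<Rightarrow> 'v) set" where
  "CE1 L s = {\<psi>. Vector_Spaces.linear (scal L) s \<psi>}"

definition CE2 :: "('f::field, 'a::ab_group_add) restricted_lie \<Rightarrow> ('f \<Rightarrow> 'v::ab_group_add \<Rightarrow> 'v) \<Rightarrow> ('a \<Rightarrow> 'a \<Rightarrow> 'v) set" where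
  "CE2 L s = {\<psi>.
     (\<forall>x. Vector_Spaces.linear (scal L) s (\<lambda>y. \<psi> x y)) \<and>
     (\<forall>y. Vector_Spaces.linear (scal L) s (\<lambda>x. \<psi> x y)) \<and>
     (\<forall>x. \<psi> x x = 0)}"

definition CE3 :: "('f::field, 'a::ab_group_add) restricted_lie \<Rightarrow> ('f \<Rightarrow> 'v::ab_group_add \<Rightarrow> 'v) \<Rightarrow> ('a \<Rightarrow> 'a \<Rightarrow> 'a \<Rightarrow> 'v) set" where
  "CE3 L s = {\<alpha>.
     (\<forall>y z. Vector_Spaces.linear (scal L) s (\<lambda>x. \<alpha> x y z)) \<and>
     (\<forall>x z. Vector_Spaces.linear (scal L) s (\<lambda>y. \<alpha> x y z)) \<and>
     (\<forall>x y. Vector_Spaces.linear (scal L) s (\<lambda>z. \<alpha> x y z)) \<and>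
     (\<forall>x y. \<alpha> x x y = 0 \<and> \<alpha> x y x = 0 \<and> \<alpha> y x x = 0)}"

definition dCE0 :: "('a \<Rightarrow> 'v \<Rightarrow> 'v) \<Rightarrow> 'v \<Rightarrow> 'a \<Rightarrow> 'v" where
  "dCE0 act m = (\<lambda>x. act x m)"

definition dCE1 ::
  "('f, 'a) restricted_lie \<Rightarrow> ('a \<Rightarrow> 'v::ab_group_add \<Rightarrow> 'v) \<Rightarrow> ('a \<Rightarrow> 'v) \<Rightarrow> 'a \<Rightarrow> 'a \<Rightarrow> 'v"
where
  "dCE1 L act \<psi> = (\<lambda>x y. - \<psi> (brk L x y) + act x (\<psi> y) - act y (\<psi> x))"

definition dCE2 ::
  "('f, 'a) restricted_lie \<Rightarrow> ('a \<Rightarrow> 'v::ab_group_add \<Rightarrow> 'v) \<Rightarrow> ('a \<Rightarrow> 'a \<Rightarrow> 'v) \<Rightarrow> 'a \<Rightarrow> 'a \<Rightarrow> 'a \<Rightarrow> 'v"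
where
  "dCE2 L act \<psi> = (\<lambda>x y z.
     - \<psi> (brk L x y) z + \<psi> (brk L x z) y - \<psi> (brk L y z) x
     + act x (\<psi> y z) - act y (\<psi> x z) + act z (\<psi> x y))"

section \<open>Restricted cochains\<close>

text \<open>
  A \<open>p\<close>-tuple of formal symbols in \<open>{x, y}\<close> is a function on \<open>{1..p}\<close> to \<open>bool\<close>, \<open>True\<close> standing
  for \<open>x\<close>; the symbols stay distinct when \<open>x = y\<close> as elements.
\<close>

definition symbol_words :: "nat \<Rightarrow> (nat \<Rightarrow> bool) set" where
  "symbol_words p = {w \<in> {1..p} \<rightarrow>\<^sub>E UNIV. w 1 \<and> \<not> w 2}"

definition letter :: "'a \<Rightarrow> 'a \<Rightarrow> (nat \<Rightarrow> bool) \<Rightarrow> nat \<Rightarrow> 'a" where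
  "letter x y w i = (if w i then x else y)"

definition num_first :: "nat \<Rightarrow> (nat \<Rightarrow> bool) \<Rightarrow> nat" where
  "num_first p w = card {i \<in> {1..p}. w i}"

text \<open>\<open>brks L a [b\<^sub>1, \<dots>, b\<^sub>n] = [\<dots>[[a, b\<^sub>1], b\<^sub>2], \<dots>, b\<^sub>n]\<close>\<close>

definition brks :: "('f, 'a) restricted_lie \<Rightarrow> 'a \<Rightarrow> 'a list \<Rightarrow> 'a" where
  "brks L a bs = foldl (brk L) a bs"

text \<open>\<open>acts act [b\<^sub>1, \<dots>, b\<^sub>n] v = b\<^sub>1 \<cdot> (b\<^sub>2 \<cdot> (\<dots> \<cdot> (b\<^sub>n \<cdot> v)))\<close>\<close>

definition acts :: "('a \<Rightarrow> 'v \<Rightarrow> 'v) \<Rightarrow> 'a list \<Rightarrow> 'v \<Rightarrow> 'v" where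
  "acts act bs v = foldr act bs v"

text \<open>\<open>ascending h m n = [h m, h (m + 1), \<dots>, h n]\<close> and
  \<open>descending h n m = [h n, h (n - 1), \<dots>, h m]\<close>, both empty for \<open>n < m\<close>.\<close>

definition ascending :: "(nat \<Rightarrow> 'a) \<Rightarrow> nat \<Rightarrow> nat \<Rightarrow> 'a list" where
  "ascending h m n = map h [m..<Suc n]"

definition descending :: "(nat \<Rightarrow> 'a) \<Rightarrow> nat \<Rightarrow> nat \<Rightarrow> 'a list" where
  "descending h n m = map h (rev [m..<Suc n])"

definition star_sum ::
  "('f::field, 'a::ab_group_add) restricted_lie \<Rightarrow> ('f \<Rightarrow> 'v::ab_group_add \<Rightarrow> 'v) \<Rightarrow> ('a \<Rightarrow> 'v \<Rightarrow> 'v) \<Rightarrow>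
   ('a \<Rightarrow> 'a \<Rightarrow> 'v) \<Rightarrow> 'a \<Rightarrow> 'a \<Rightarrow> 'v"
where
  "star_sum L s act \<psi> x y = (let p = CHAR('f) in
     \<Sum>w \<in> symbol_words p. let h = letter x y w in
       s (inverse (of_nat (num_first p w)))
         (\<Sum>k = 0..p - 2. s ((- 1) ^ k)
            (acts act (descending h p (p - k + 1))
              (\<psi> (brks L (h 1) (ascending h 2 (p - k - 1))) (h (p - k))))))"

definition star_property ::
  "('f::field, 'a::ab_group_add) restricted_lie \<Rightarrow> ('f \<Rightarrow> 'v::ab_group_add \<Rightarrow> 'v) \<Rightarrow> ('a \<Rightarrow> 'v \<Rightarrow> 'v) \<Rightarrow>
   ('a \<Rightarrow> 'a \<Rightarrow> 'v) \<Rightarrow> ('a \<Rightarrow> 'v) \<Rightarrow> bool"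
where
  "star_property L s act \<psi> \<omega> \<longleftrightarrow>
     (\<forall>c x. \<omega> (scal L c x) = s (c ^ CHAR('f)) (\<omega> x)) \<and>
     (\<forall>x y. \<omega> (x + y) = \<omega> x + \<omega> y + star_sum L s act \<psi> x y)"

definition star_star_sum ::
  "('f::field, 'a::ab_group_add) restricted_lie \<Rightarrow> ('f \<Rightarrow> 'v::ab_group_add \<Rightarrow> 'v) \<Rightarrow> ('a \<Rightarrow> 'v \<Rightarrow> 'v) \<Rightarrow>
   ('a \<Rightarrow> 'a \<Rightarrow> 'a \<Rightarrow> 'v) \<Rightarrow> 'a \<Rightarrow> 'a \<Rightarrow> 'a \<Rightarrow> 'v"
where
  "star_star_sum L s act \<alpha> x y1 y2 = (let p = CHAR('f) in
     \<Sum>w \<in> symbol_words p. let h = letter y1 y2 w in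
       s (inverse (of_nat (num_first p w)))
         (\<Sum>j = 0..p - 2. s ((- 1) ^ j)
            (\<Sum>k = 0..j. s (of_nat (j choose k))
               (acts act (descending h p (p - k + 1))
                 (\<alpha> (brks L x (descending h (p - k) (p - j + 1)))
                    (brks L (h 1) (ascending h 2 (p - j - 1)))
                    (h (p - j)))))))"

definition star_star_property ::
  "('f::field, 'a::ab_group_add) restricted_lie \<Rightarrow> ('f \<Rightarrow> 'v::ab_group_add \<Rightarrow> 'v) \<Rightarrow> ('a \<Rightarrow> 'v \<Rightarrow> 'v) \<Rightarrow>
   ('a \<Rightarrow> 'a \<Rightarrow> 'a \<Rightarrow> 'v) \<Rightarrow> ('a \<Rightarrow> 'a \<Rightarrow> 'v) \<Rightarrow> bool"
where
  "star_star_property L s act \<alpha> \<beta> \<longleftrightarrow>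
     (\<forall>y. Vector_Spaces.linear (scal L) s (\<lambda>x. \<beta> x y)) \<and>
     (\<forall>c x y. \<beta> x (scal L c y) = s (c ^ CHAR('f)) (\<beta> x y)) \<and>
     (\<forall>x y1 y2. \<beta> x (y1 + y2) = \<beta> x y1 + \<beta> x y2 - star_star_sum L s act \<alpha> x y1 y2)"

definition Cst0 :: "'v set" where
  "Cst0 = UNIV"

definition Cst1 :: "('f::field, 'a::ab_group_add) restricted_lie \<Rightarrow> ('f \<Rightarrow> 'v::ab_group_add \<Rightarrow> 'v) \<Rightarrow> ('a \<Rightarrow> 'v) set" where
  "Cst1 L s = CE1 L s"

definition Cst2 ::
  "('f::field, 'a::ab_group_add) restricted_lie \<Rightarrow> ('f \<Rightarrow> 'v::ab_group_add \<Rightarrow> 'v) \<Rightarrow> ('a \<Rightarrow> 'v \<Rightarrow> 'v) \<Rightarrow>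
   (('a \<Rightarrow> 'a \<Rightarrow> 'v) \<times> ('a \<Rightarrow> 'v)) set"
where
  "Cst2 L s act = {(\<psi>, \<omega>). \<psi> \<in> CE2 L s \<and> star_property L s act \<psi> \<omega>}"

definition Cst3 ::
  "('f::field, 'a::ab_group_add) restricted_lie \<Rightarrow> ('f \<Rightarrow> 'v::ab_group_add \<Rightarrow> 'v) \<Rightarrow> ('a \<Rightarrow> 'v \<Rightarrow> 'v) \<Rightarrow>
   (('a \<Rightarrow> 'a \<Rightarrow> 'a \<Rightarrow> 'v) \<times> ('a \<Rightarrow> 'a \<Rightarrow> 'v)) set"
where
  "Cst3 L s act = {(\<alpha>, \<beta>). \<alpha> \<in> CE3 L s \<and> star_star_property L s act \<alpha> \<beta>}"

definition Cst2_tilde ::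
  "('f::field, 'a::ab_group_add) restricted_lie \<Rightarrow> ('f \<Rightarrow> 'v::ab_group_add \<Rightarrow> 'v) \<Rightarrow>
   (('a \<Rightarrow> 'a \<Rightarrow> 'v) \<times> ('a \<Rightarrow> 'v)) set"
where
  "Cst2_tilde L s = {(\<psi>, \<omega>). \<psi> \<in> CE2 L s \<and> (\<forall>c x. \<omega> (scal L c x) = s (c ^ CHAR('f)) (\<omega> x))}"

definition ind1 ::
  "('f::field, 'a) restricted_lie \<Rightarrow> ('a \<Rightarrow> 'v::ab_group_add \<Rightarrow> 'v) \<Rightarrow> ('a \<Rightarrow> 'v) \<Rightarrow> 'a \<Rightarrow> 'v"
where
  "ind1 L act \<psi> = (\<lambda>x. - \<psi> (pmap L x) + (act x ^^ (CHAR('f) - 1)) (\<psi> x))"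

definition ind2 ::
  "('f::field, 'a) restricted_lie \<Rightarrow> ('f \<Rightarrow> 'v::ab_group_add \<Rightarrow> 'v) \<Rightarrow> ('a \<Rightarrow> 'v \<Rightarrow> 'v) \<Rightarrow>
   ('a \<Rightarrow> 'a \<Rightarrow> 'v) \<Rightarrow> ('a \<Rightarrow> 'v) \<Rightarrow> 'a \<Rightarrow> 'a \<Rightarrow> 'v"
where
  "ind2 L s act \<alpha> \<beta> = (\<lambda>x y.
     - \<alpha> x (pmap L y)
     + (\<Sum>(i, j) \<in> {(i, j). i + j = CHAR('f) - 1}.
          s ((- 1) ^ i) ((act y ^^ i) (\<alpha> (((\<lambda>u. brk L u y) ^^ j) x) y)))
     - act x (\<beta> y))"

section \<open>The restricted deformation complex of a morphism\<close>

text \<open>The adjoint action is \<open>brk\<close> itself.\<close>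

definition pullback_act :: "('f, 'b) restricted_lie \<Rightarrow> ('a \<Rightarrow> 'b) \<Rightarrow> 'a \<Rightarrow> 'b \<Rightarrow> 'b" where
  "pullback_act M \<phi> x m = brk M (\<phi> x) m"

lemma restricted_module_adjoint:
  fixes L :: "('f::field, 'a::ab_group_add) restricted_lie"
  assumes "restricted_lie_algebra L"
  shows "restricted_module L (scal L) (brk L)"
proof -
  have L: "lie_algebra L" and char: "CHAR('f) > 0"
    and p: "\<And>x y. brk L x (pmap L y) = ((\<lambda>u. brk L u y) ^^ CHAR('f)) x"
    using assms by (auto simp: restricted_lie_algebra_def)
  have vs: "vector_space (scal L)"
    and lr: "\<And>x. Vector_Spaces.linear (scal L) (scal L) (\<lambda>y. brk L x y)"
    and ll: "\<And>y. Vector_Spaces.linear (scal L) (scal L) (\<lambda>x. brk L x y)"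
    and alt: "\<And>x. brk L x x = 0"
    and jac: "\<And>x y z. brk L x (brk L y z) + brk L y (brk L z x) + brk L z (brk L x y) = 0"
    using L by (auto simp: lie_algebra_def)
  interpret vector_space "scal L" by (fact vs)
  have add_r: "brk L x (y + z) = brk L x y + brk L x z" for x y z
    using lr[of x, folded module_hom_iff_linear] by (rule module_hom.add)
  have add_l: "brk L (y + z) x = brk L y x + brk L z x" for x y z
    using ll[of x, folded module_hom_iff_linear] by (rule module_hom.add)
  have scale_r: "brk L x (scal L c y) = scal L c (brk L x y)" for c x y
    using lr[of x, folded module_hom_iff_linear] by (rule module_hom.scale)
  have skew: "brk L y x = - brk L x y" for x y
  proof -
    have "brk L y x + brk L x y = 0"
      using alt[of "x + y"] unfolding add_l add_r by (simp add: alt)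
    thus ?thesis by (simp add: eq_neg_iff_add_eq_0)
  qed
  have neg_r: "brk L x (- y) = - brk L x y" for x y
    using lr[of x, folded module_hom_iff_linear] by (rule module_hom.neg)
  have rep: "brk L (brk L x y) v = brk L x (brk L y v) - brk L y (brk L x v)" for x y v
  proof -
    have "brk L x (brk L y v) - brk L y (brk L x v) + brk L v (brk L x y) = 0"
      using jac[of x y v] by (simp add: skew[of v x] neg_r)
    thus ?thesis using skew[of v "brk L x y"] by (metis eq_neg_iff_add_eq_0 minus_minus)
  qed
  have pw: "((\<lambda>u. brk L u x) ^^ n) v = scal L ((- 1) ^ n) ((brk L x ^^ n) v)" for n x v
  proof (induction n)
    case (Suc n)
    have "((\<lambda>u. brk L u x) ^^ Suc n) v = - brk L x (((\<lambda>u. brk L u x) ^^ n) v)"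
      using skew[of x "((\<lambda>u. brk L u x) ^^ n) v"] by simp
    thus ?case by (simp add: Suc.IH scale_r)
  qed simp
  have "prime CHAR('f)" using char by (rule prime_CHAR_semidom)
  hence "(- 1 :: 'f) ^ CHAR('f) = - 1" using minus_power_prime_CHAR[OF refl, where x = "1 :: 'f"] by simp
  hence res: "brk L (pmap L x) v = (brk L x ^^ CHAR('f)) v" for x v
    using skew[of v "pmap L x"] by (simp add: p pw)
  show ?thesis
    unfolding restricted_module_def using vs lr ll rep res by blast
qed

lemma restricted_module_pullback:
  fixes L :: "('f::field, 'a::ab_group_add) restricted_lie" and M :: "('f, 'b::ab_group_add) restricted_lie"
  assumes "restricted_lie_algebra M" and "restricted_morphism L M \<phi>"
  shows "restricted_module L (scal M) (pullback_act M \<phi>)"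
proof -
  note M = restricted_module_adjoint[OF assms(1), unfolded restricted_module_def]
  note \<phi> = assms(2)[unfolded restricted_morphism_def]
  have act: "pullback_act M \<phi> x = brk M (\<phi> x)" for x
    by (auto simp: pullback_act_def)
  have "Vector_Spaces.linear (scal L) (scal M) (\<lambda>x. brk M (\<phi> x) v)" for v
    using Vector_Spaces.linear_compose[of "scal L" "scal M" \<phi> "scal M" "\<lambda>x. brk M x v"] M \<phi>
    by (simp add: o_def)
  thus ?thesis
    unfolding restricted_module_def act using M \<phi> by simp
qed

type_synonym ('a, 'b) def_cochain1 = "('a \<Rightarrow> 'a) \<times> ('b \<Rightarrow> 'b) \<times> 'b"

type_synonym ('a, 'b) def_cochain2 =
  "(('a \<Rightarrow> 'a \<Rightarrow> 'a) \<times> ('a \<Rightarrow> 'a)) \<times> (('b \<Rightarrow> 'b \<Rightarrow> 'b) \<times> ('b \<Rightarrow> 'b)) \<times> ('a \<Rightarrow> 'b)"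

type_synonym ('a, 'b) def_cochain3 =
  "(('a \<Rightarrow> 'a \<Rightarrow> 'a \<Rightarrow> 'a) \<times> ('a \<Rightarrow> 'a \<Rightarrow> 'a)) \<times> (('b \<Rightarrow> 'b \<Rightarrow> 'b \<Rightarrow> 'b) \<times> ('b \<Rightarrow> 'b \<Rightarrow> 'b)) \<times>
   (('a \<Rightarrow> 'a \<Rightarrow> 'b) \<times> ('a \<Rightarrow> 'b))"

text \<open>The zero space is realised as the zero subspace of the ground field.\<close>

definition def_C0 :: "('f::field, 'a) restricted_lie \<Rightarrow> ('f, 'b) restricted_lie \<Rightarrow> 'f set" where
  "def_C0 L M = {0}"

definition def_C1 ::
  "('f::field, 'a::ab_group_add) restricted_lie \<Rightarrow> ('f, 'b::ab_group_add) restricted_lie \<Rightarrow>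
   ('a, 'b) def_cochain1 set"
where
  "def_C1 L M = Cst1 L (scal L) \<times> Cst1 M (scal M) \<times> Cst0"

definition def_C2 ::
  "('f::field, 'a::ab_group_add) restricted_lie \<Rightarrow> ('f, 'b::ab_group_add) restricted_lie \<Rightarrow>
   ('a, 'b) def_cochain2 set"
where
  "def_C2 L M = Cst2 L (scal L) (brk L) \<times> Cst2 M (scal M) (brk M) \<times> Cst1 L (scal M)"

definition def_C3 ::
  "('f::field, 'a::ab_group_add) restricted_lie \<Rightarrow> ('f, 'b::ab_group_add) restricted_lie \<Rightarrow>
   ('a, 'b) def_cochain3 set"
where
  "def_C3 L M = Cst3 L (scal L) (brk L) \<times> Cst3 M (scal M) (brk M) \<times> Cst2_tilde L (scal M)"

definition def_d0 ::
  "('f::field, 'a::ab_group_add) restricted_lie \<Rightarrow> ('f, 'b::ab_group_add) restricted_lie \<Rightarrow>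
   'f \<Rightarrow> ('a, 'b) def_cochain1"
where
  "def_d0 L M = (\<lambda>_. 0)"

definition def_d1 ::
  "('f::field, 'a::ab_group_add) restricted_lie \<Rightarrow> ('f, 'b::ab_group_add) restricted_lie \<Rightarrow> ('a \<Rightarrow> 'b) \<Rightarrow>
   ('a, 'b) def_cochain1 \<Rightarrow> ('a, 'b) def_cochain2"
where
  "def_d1 L M \<phi> = (\<lambda>(\<gamma>, \<tau>, m).
     ((dCE1 L (brk L) \<gamma>, ind1 L (brk L) \<gamma>),
      (dCE1 M (brk M) \<tau>, ind1 M (brk M) \<tau>),
      (\<lambda>x. \<phi> (\<gamma> x) - \<tau> (\<phi> x) - dCE0 (pullback_act M \<phi>) m x)))"

definition def_alpha ::
  "('f, 'a::ab_group_add) restricted_lie \<Rightarrow> ('f, 'b::ab_group_add) restricted_lie \<Rightarrow> ('a \<Rightarrow> 'b) \<Rightarrow>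
   ('a \<Rightarrow> 'a \<Rightarrow> 'a) \<Rightarrow> ('b \<Rightarrow> 'b \<Rightarrow> 'b) \<Rightarrow> ('a \<Rightarrow> 'b) \<Rightarrow> 'a \<Rightarrow> 'a \<Rightarrow> 'b"
where
  "def_alpha L M \<phi> \<mu> \<nu> \<theta> =
     (\<lambda>x y. \<phi> (\<mu> x y) - \<nu> (\<phi> x) (\<phi> y) - dCE1 L (pullback_act M \<phi>) \<theta> x y)"

definition def_beta ::
  "('f::field, 'a::ab_group_add) restricted_lie \<Rightarrow> ('f, 'b::ab_group_add) restricted_lie \<Rightarrow> ('a \<Rightarrow> 'b) \<Rightarrow>
   ('a \<Rightarrow> 'a) \<Rightarrow> ('b \<Rightarrow> 'b) \<Rightarrow> ('a \<Rightarrow> 'b) \<Rightarrow> 'a \<Rightarrow> 'b"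
where
  "def_beta L M \<phi> \<omega> \<epsilon> \<theta> =
     (\<lambda>x. \<theta> (pmap L x) + \<phi> (\<omega> x) - \<epsilon> (\<phi> x) - (pullback_act M \<phi> x ^^ (CHAR('f) - 1)) (\<theta> x))"

definition def_d2 ::
  "('f::field, 'a::ab_group_add) restricted_lie \<Rightarrow> ('f, 'b::ab_group_add) restricted_lie \<Rightarrow> ('a \<Rightarrow> 'b) \<Rightarrow>
   ('a, 'b) def_cochain2 \<Rightarrow> ('a, 'b) def_cochain3"
where
  "def_d2 L M \<phi> = (\<lambda>((\<mu>, \<omega>), (\<nu>, \<epsilon>), \<theta>).
     ((dCE2 L (brk L) \<mu>, ind2 L (scal L) (brk L) \<mu> \<omega>),
      (dCE2 M (brk M) \<nu>, ind2 M (scal M) (brk M) \<nu> \<epsilon>),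
      (def_alpha L M \<phi> \<mu> \<nu> \<theta>, def_beta L M \<phi> \<omega> \<epsilon> \<theta>)))"

definition def_Z1 ::
  "('f::field, 'a::ab_group_add) restricted_lie \<Rightarrow> ('f, 'b::ab_group_add) restricted_lie \<Rightarrow> ('a \<Rightarrow> 'b) \<Rightarrow>
   ('a, 'b) def_cochain1 set"
where
  "def_Z1 L M \<phi> = {c \<in> def_C1 L M. def_d1 L M \<phi> c = 0}"

definition def_B1 ::
  "('f::field, 'a::ab_group_add) restricted_lie \<Rightarrow> ('f, 'b::ab_group_add) restricted_lie \<Rightarrow>
   ('a, 'b) def_cochain1 set"
where
  "def_B1 L M = def_d0 L M ` def_C0 L M"

definition def_Z2 ::
  "('f::field, 'a::ab_group_add) restricted_lie \<Rightarrow> ('f, 'b::ab_group_add) restricted_lie \<Rightarrow> ('a \<Rightarrow> 'b) \<Rightarrow>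
   ('a, 'b) def_cochain2 set"
where
  "def_Z2 L M \<phi> = {c \<in> def_C2 L M. def_d2 L M \<phi> c = 0}"

definition def_B2 ::
  "('f::field, 'a::ab_group_add) restricted_lie \<Rightarrow> ('f, 'b::ab_group_add) restricted_lie \<Rightarrow> ('a \<Rightarrow> 'b) \<Rightarrow>
   ('a, 'b) def_cochain2 set"
where
  "def_B2 L M \<phi> = def_d1 L M \<phi> ` def_C1 L M"

definition def_scale1 ::
  "('f, 'a) restricted_lie \<Rightarrow> ('f, 'b) restricted_lie \<Rightarrow> 'f \<Rightarrow> ('a, 'b) def_cochain1 \<Rightarrow> ('a, 'b) def_cochain1"
where
  "def_scale1 L M c = (\<lambda>(\<gamma>, \<tau>, m). (\<lambda>x. scal L c (\<gamma> x), \<lambda>x. scal M c (\<tau> x), scal M c m))"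

definition def_scale2 ::
  "('f, 'a) restricted_lie \<Rightarrow> ('f, 'b) restricted_lie \<Rightarrow> 'f \<Rightarrow> ('a, 'b) def_cochain2 \<Rightarrow> ('a, 'b) def_cochain2"
where
  "def_scale2 L M c = (\<lambda>((\<mu>, \<omega>), (\<nu>, \<epsilon>), \<theta>).
     ((\<lambda>x y. scal L c (\<mu> x y), \<lambda>x. scal L c (\<omega> x)),
      (\<lambda>x y. scal M c (\<nu> x y), \<lambda>x. scal M c (\<epsilon> x)),
      (\<lambda>x. scal M c (\<theta> x))))"

section \<open>Quotients of vector spaces\<close>

definition quotient_relation :: "'c::ab_group_add set \<Rightarrow> 'c set \<Rightarrow> ('c \<times> 'c) set" where
  "quotient_relation Z B = {(u, v). u \<in> Z \<and> v \<in> Z \<and> u - v \<in> B}"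

definition quotient_space :: "'c::ab_group_add set \<Rightarrow> 'c set \<Rightarrow> 'c set set" where
  "quotient_space Z B = Z // quotient_relation Z B"

text \<open>The quotient \<open>Z / B\<close> makes sense: \<open>B \<subseteq> Z\<close> are subspaces of an ambient vector space with scalar
  multiplication \<open>s\<close>, and the operations of \<open>Z\<close> descend to cosets.\<close>

definition quotient_well_defined ::
  "('f::field \<Rightarrow> 'c::ab_group_add \<Rightarrow> 'c) \<Rightarrow> 'c set \<Rightarrow> 'c set \<Rightarrow> bool"
where
  "quotient_well_defined s Z B \<longleftrightarrow>
     vector_space s \<and> module.subspace s Z \<and> module.subspace s B \<and> B \<subseteq> Z \<and>
     equiv Z (quotient_relation Z B) \<and>
     (\<forall>\<xi> \<in> quotient_space Z B. \<forall>\<eta> \<in> quotient_space Z B.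
        \<exists>!\<zeta> \<in> quotient_space Z B. \<forall>u \<in> \<xi>. \<forall>v \<in> \<eta>. u + v \<in> \<zeta>) \<and>
     (\<forall>c. \<forall>\<xi> \<in> quotient_space Z B. \<exists>!\<zeta> \<in> quotient_space Z B. \<forall>u \<in> \<xi>. s c u \<in> \<zeta>)"

end

theory Submission
  imports Defs "HOL-Computational_Algebra.Formal_Power_Series"
begin

text \<open>
  Everything reduces to Jacobson's formula for \<open>(X + Y) ^ p\<close> in an associative ring of characteristic \<open>p\<close>.
  For a linear map \<open>\<psi>\<close> from \<open>L\<close> to a module \<open>V\<close>, apply it to the operators \<open>(v, c) \<mapsto> (x \<cdot> v + c \<psi>(x), 0)\<close>
  on \<open>V \<oplus> F\<close> and evaluate at \<open>(0, 1)\<close>: this is the \<open>(*)\<close>-property of \<open>ind\<^sup>1(\<psi>)\<close> with respect to \<open>d\<^sup>1\<psi>\<close>.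
  The \<open>(**)\<close>-property of \<open>ind\<^sup>2(\<alpha>, \<beta>)\<close> is the \<open>(*)\<close>-property for the module \<open>W = Hom(L, V)\<close> and the linear map
  \<open>y \<mapsto> \<alpha>(\<cdot>, y)\<close> into it, because \<open>(-1)\<^sup>i\<close> is the binomial coefficient of \<open>p - 1\<close> over \<open>i\<close>, so that
  \<open>ind\<^sup>2(\<alpha>, \<beta>)(x, y) = ind\<^sup>1(y \<mapsto> \<alpha>(\<cdot>, y))(y)(x) - x \<cdot> \<beta>(y)\<close>.
  With \<open>\<iota> : V \<rightarrow> W\<close>, \<open>\<iota> v = (x \<mapsto> x \<cdot> v)\<close>, which is equivariant, \<open>d\<psi>(\<cdot>, y) = \<iota>(\<psi> y) - y \<cdot> \<psi>\<close> and the
  restrictedness of \<open>W\<close> give \<open>ind\<^sup>2(d\<psi>, ind\<^sup>1 \<psi>) = 0\<close>.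
\<close>

section \<open>Jacobson's formula in an associative ring\<close>

definition words :: "nat \<Rightarrow> nat \<Rightarrow> bool list set" where
  "words n i = {w. length w = n \<and> count_list w True = i}"

lemma finite_words [simp]: "finite (words n i)"
  by (rule finite_subset[OF _ finite_lists_length_eq[of "UNIV :: bool set" n]]) (auto simp: words_def)

lemma sum_words_snoc:
  fixes F :: "bool list \<Rightarrow> 'b::comm_monoid_add"
  shows "(\<Sum>w\<in>words (Suc n) i. F w) =
    (case i of 0 \<Rightarrow> 0 | Suc j \<Rightarrow> \<Sum>w\<in>words n j. F (w @ [True])) + (\<Sum>w\<in>words n i. F (w @ [False]))"
proof -
  let ?T = "case i of 0 \<Rightarrow> {} | Suc j \<Rightarrow> (\<lambda>w. w @ [True]) ` words n j"
  let ?F = "(\<lambda>w. w @ [False]) ` words n i"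
  have eq: "words (Suc n) i = ?T \<union> ?F"
  proof (intro set_eqI iffI)
    fix w assume w: "w \<in> words (Suc n) i"
    hence "w \<noteq> []" by (auto simp: words_def)
    then obtain v b where "w = v @ [b]" by (metis rev_exhaust)
    thus "w \<in> ?T \<union> ?F" using w by (cases b) (auto simp: words_def)
  qed (auto simp: words_def split: nat.splits)
  have "(\<Sum>w\<in>words (Suc n) i. F w) = sum F ?T + sum F ?F"
    unfolding eq by (rule sum.union_disjoint) (auto split: nat.splits)
  also have "sum F ?F = (\<Sum>w\<in>words n i. F (w @ [False]))"
    by (subst sum.reindex) (auto simp: inj_on_def)
  also have "sum F ?T = (case i of 0 \<Rightarrow> 0 | Suc j \<Rightarrow> \<Sum>w\<in>words n j. F (w @ [True]))"
    by (auto split: nat.splits simp: sum.reindex inj_on_def)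
  finally show ?thesis .
qed

text \<open>Reversal is a bijection of \<open>words m j\<close>, so splitting off the first letter
  reduces to splitting off the last one.\<close>

lemma sum_words_Cons:
  fixes F :: "bool list \<Rightarrow> 'b::comm_monoid_add"
  shows "(\<Sum>w\<in>words (Suc n) i. F w) =
    (case i of 0 \<Rightarrow> 0 | Suc j \<Rightarrow> \<Sum>w\<in>words n j. F (True # w)) + (\<Sum>w\<in>words n i. F (False # w))"
proof -
  have rev: "(\<Sum>w\<in>words m j. G (rev w)) = (\<Sum>w\<in>words m j. G w)" for m j and G :: "bool list \<Rightarrow> 'b"
    by (rule sum.reindex_bij_witness[of _ rev rev]) (auto simp: words_def)
  have "(\<Sum>w\<in>words (Suc n) i. F w) = (\<Sum>w\<in>words (Suc n) i. F (rev w))" by (simp only: rev)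
  also have "\<dots> = (case i of 0 \<Rightarrow> 0 | Suc j \<Rightarrow> \<Sum>w\<in>words n j. F (True # rev w)) + (\<Sum>w\<in>words n i. F (False # rev w))"
    by (simp only: sum_words_snoc rev_append rev.simps append.simps)
  finally show ?thesis
    using rev[where G = "\<lambda>w. F (True # w)"] rev[where G = "\<lambda>w. F (False # w)"] by (simp split: nat.splits)
qed

text \<open>The recursion makes \<open>Q n i\<close> the coefficient of \<open>Z ^ i\<close> in the
  \<open>n\<close>-th power of \<open>Z D True + D False\<close> applied to \<open>q\<close>.
  Multiplying out gives one summand per word, with \<open>i\<close> factors \<open>D True\<close>;
  \<open>fold\<close> applies the first letter first. The lemma serves both for
  \<open>ad_line\<close> and for commutators with a power series.\<close>

lemma two_letter_expansion:
  fixes D :: "bool \<Rightarrow> 'b::ab_group_add \<Rightarrow> 'b" and Q :: "nat \<Rightarrow> nat \<Rightarrow> 'b"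
  assumes D: "\<And>b. additive (D b)"
    and Q0: "\<And>i. Q 0 i = (if i = 0 then q else 0)"
    and QSuc: "\<And>n i. Q (Suc n) i = (case i of 0 \<Rightarrow> 0 | Suc j \<Rightarrow> D True (Q n j)) + D False (Q n i)"
  shows "Q n i = (\<Sum>w\<in>words n i. fold D w q)"
proof (induction n arbitrary: i)
  case 0
  have "words 0 i = (if i = 0 then {[]} else {})" by (auto simp: words_def)
  thus ?case by (simp add: Q0)
next
  case (Suc n)
  show ?case
    by (auto simp: QSuc Suc.IH sum_words_snoc additive.sum[OF D] split: nat.splits)
qed

section \<open>Commutators and derivatives of powers in characteristic p\<close>

lemma of_nat_prime_choose_minus_one:
  assumes p: "prime p" and char: "of_nat p = (0::'r::ring_1)" and "k \<le> p - 1"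
  shows "of_nat ((p - 1) choose k) = ((- 1) ^ k :: 'r)"
  using assms(3)
proof (induction k)
  case (Suc k)
  have "p > 1" using p by (rule prime_gt_1_nat)
  \<comment> \<open>By Pascal's rule two neighbouring binomials of \<open>p - 1\<close> add up to
    one of \<open>p\<close>, which is divisible by \<open>p\<close>; hence their signs
    alternate.\<close>
  hence "p choose Suc k = ((p - 1) choose k) + ((p - 1) choose Suc k)"
    by (metis Suc_diff_1 binomial_Suc_Suc less_trans zero_less_one)
  moreover have "p dvd p choose Suc k"
    using p Suc.prems \<open>p > 1\<close> by (intro dvd_choose_prime) auto
  hence "of_nat (p choose Suc k) = (0::'r)" using char by (auto elim!: dvdE)
  ultimately have "of_nat ((p - 1) choose Suc k) = - (of_nat ((p - 1) choose k) :: 'r)"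
    by (metis add_eq_0_iff of_nat_add)
  thus ?case using Suc by simp
qed simp

text \<open>Left and right multiplication by \<open>P\<close> commute, so this is the binomial
  theorem for a power of their difference.\<close>

lemma right_comm_power:
  fixes P x :: "'r::ring_1"
  shows "((\<lambda>u. u * P - P * u) ^^ n) x = (\<Sum>k\<le>n. (- 1) ^ k * of_nat (n choose k) * (P ^ k * x * P ^ (n - k)))"
proof (induction n)
  case (Suc n)
  let ?t = "\<lambda>c k l. (- 1) ^ k * of_nat c * (P ^ k * x * P ^ l) :: 'r"
  have "((\<lambda>u. u * P - P * u) ^^ Suc n) x = (\<Sum>k\<le>n. ?t (n choose k) k (Suc n - k)) - (\<Sum>k\<le>n. P * ?t (n choose k) k (n - k))"
    by (simp add: Suc.IH sum_distrib_left sum_distrib_right mult.assoc Suc_diff_le power_commutes flip: power_Suc2)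
  also have "(\<Sum>k\<le>n. P * ?t (n choose k) k (n - k)) = - (\<Sum>k\<le>n. ?t (n choose k) (Suc k) (n - k))"
  proof -
    have "P * ((- 1) ^ k * of_nat c * y) = (- 1) ^ k * of_nat c * (P * y)" for k c and y :: 'r
      using mult_of_nat_commute[of c P] by (cases "even k") (simp_all flip: mult.assoc)
    thus ?thesis by (simp add: sum_negf mult.assoc)
  qed
  also have "(\<Sum>k\<le>n. ?t (n choose k) k (Suc n - k)) = (\<Sum>k\<le>Suc n. ?t (n choose k) k (Suc n - k))"
    by (simp add: binomial_eq_0)
  also have "\<dots> = ?t 1 0 (Suc n) + (\<Sum>k\<le>n. ?t (n choose Suc k) (Suc k) (n - k))"
    by (subst sum.atMost_Suc_shift) simp
  also have "\<dots> - - (\<Sum>k\<le>n. ?t (n choose k) (Suc k) (n - k)) =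
     ?t 1 0 (Suc n) + (\<Sum>k\<le>n. ?t (Suc n choose Suc k) (Suc k) (n - k))"
    by (simp add: sum_negf sum_subtractf left_diff_distrib sum.distrib distrib_left distrib_right)
  also have "\<dots> = (\<Sum>k\<le>Suc n. ?t (Suc n choose k) k (Suc n - k))"
    by (subst sum.atMost_Suc_shift) simp
  finally show ?case .
qed simp

text \<open>Leibniz rule for a \<open>P\<close> that may fail to commute with its derivative: each
  summand keeps the place of the differentiated factor.\<close>

lemma fps_deriv_noncomm_power:
  fixes P :: "'r::ring_1 fps"
  shows "fps_deriv (P ^ Suc n) = (\<Sum>k\<le>n. P ^ k * fps_deriv P * P ^ (n - k))"
proof (induction n)
  case (Suc n)
  have "fps_deriv (P ^ Suc (Suc n)) = P ^ Suc n * fps_deriv P + fps_deriv (P ^ Suc n) * P"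
    by (subst power_Suc2) (simp only: fps_deriv_mult)
  also have "fps_deriv (P ^ Suc n) * P = (\<Sum>k\<le>n. P ^ k * fps_deriv P * P ^ (Suc n - k))"
    unfolding Suc.IH by (simp add: sum_distrib_right mult.assoc Suc_diff_le power_Suc2 del: power_Suc flip: power_Suc2)
  finally show ?case by (simp add: add.commute)
qed simp

text \<open>The binomials of \<open>p - 1\<close> are signs and cancel those of
  \<open>right_comm_power\<close>. What remains has the shape of the derivative of
  \<open>P ^ p\<close>.\<close>

lemma right_comm_power_prime:
  fixes P x :: "'r::ring_1"
  assumes p: "prime p" and char: "of_nat p = (0::'r)"
  shows "((\<lambda>u. u * P - P * u) ^^ (p - 1)) x = (\<Sum>k\<le>p - 1. P ^ k * x * P ^ (p - 1 - k))"
  unfolding right_comm_power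
proof (rule sum.cong[OF refl])
  fix k assume "k \<in> {..p - 1}"
  hence "of_nat ((p - 1) choose k) = ((- 1) ^ k :: 'r)"
    using of_nat_prime_choose_minus_one[OF p char] by simp
  moreover have "(- 1) ^ k * (- 1) ^ k = (1 :: 'r)" by (simp flip: power_add)
  ultimately show "(- 1) ^ k * of_nat ((p - 1) choose k) * (P ^ k * x * P ^ (p - 1 - k)) = P ^ k * x * P ^ (p - 1 - k)"
    by simp
qed

text \<open>The sum of all products of \<open>n\<close> factors of which \<open>i\<close> are
  \<open>X\<close> and the others \<open>Y\<close>. The variable \<open>fps_X\<close> is central
  even when \<open>X\<close> and \<open>Y\<close> do not commute.\<close>

definition shuffle_power :: "'r::ring_1 \<Rightarrow> 'r \<Rightarrow> nat \<Rightarrow> nat \<Rightarrow> 'r" where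
  "shuffle_power X Y n i = fps_nth ((fps_const X * fps_X + fps_const Y) ^ n) i"

lemma shuffle_power_Suc:
  "shuffle_power X Y (Suc n) i = (case i of 0 \<Rightarrow> 0 | Suc j \<Rightarrow> X * shuffle_power X Y n j) + Y * shuffle_power X Y n i"
  by (auto simp: shuffle_power_def distrib_right mult.assoc split: nat.splits)

lemma shuffle_power_eq_0: "i > n \<Longrightarrow> shuffle_power X Y n i = 0"
proof (induction n arbitrary: i)
  case 0
  thus ?case by (simp add: shuffle_power_def)
next
  case (Suc n)
  thus ?case by (simp add: shuffle_power_Suc split: nat.splits)
qed

lemma shuffle_power_0: "shuffle_power X Y n 0 = Y ^ n"
  by (induction n) (simp_all add: shuffle_power_Suc, simp add: shuffle_power_def)

lemma shuffle_power_self: "shuffle_power X Y n n = X ^ n"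
  by (induction n) (simp_all add: shuffle_power_Suc shuffle_power_eq_0, simp add: shuffle_power_def)

text \<open>This is the value of \<open>(X Z + Y) ^ n\<close> at \<open>Z = 1\<close>, obtained from
  the recursion instead of an evaluation of series.\<close>

lemma sum_shuffle_power: "(\<Sum>i\<le>n. shuffle_power X Y n i) = (X + Y) ^ n"
proof (induction n)
  case (Suc n)
  have "(\<Sum>i\<le>Suc n. shuffle_power X Y (Suc n) i) = X * (\<Sum>i\<le>n. shuffle_power X Y n i) + Y * (\<Sum>i\<le>Suc n. shuffle_power X Y n i)"
  proof -
    have "(\<Sum>i\<le>Suc n. case i of 0 \<Rightarrow> 0 | Suc j \<Rightarrow> X * shuffle_power X Y n j) = X * (\<Sum>i\<le>n. shuffle_power X Y n i)"
      by (subst sum.atMost_Suc_shift) (simp add: sum_distrib_left)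
    thus ?thesis by (simp add: shuffle_power_Suc sum.distrib sum_distrib_left del: sum.atMost_Suc)
  qed
  thus ?case using Suc by (simp add: shuffle_power_eq_0 distrib_right)
qed (simp add: shuffle_power_def)

text \<open>The derivative of \<open>(X Z + Y) ^ p\<close> with respect to the central variable \<open>Z\<close> is
  \<open>(R - L) ^ (p - 1) X\<close> for the left and right multiplications \<open>L\<close>, \<open>R\<close> by \<open>X Z + Y\<close>.\<close>

lemma jacobson_coefficient:
  fixes X Y :: "'r::ring_1"
  assumes p: "prime p" and char: "of_nat p = (0::'r)" and n: "p = Suc (Suc n)"
  defines "D \<equiv> \<lambda>b u. u * (if b then X else Y) - (if b then X else Y) * u"
  shows "of_nat (Suc i) * shuffle_power X Y p (Suc i) = (\<Sum>w\<in>words n i. fold D w (X * Y - Y * X))"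
proof -
  define P where "P = fps_const X * fps_X + fps_const Y"
  define R where "R = (\<lambda>u. u * P - P * u)"
  have char': "of_nat p = (0 :: 'r fps)" using char by (simp flip: fps_of_nat)
  have dP: "fps_deriv P = fps_const X" by (simp add: P_def)
  have "fps_deriv (P ^ p) = (\<Sum>k\<le>Suc n. P ^ k * fps_const X * P ^ (Suc n - k))"
    by (simp only: n fps_deriv_noncomm_power dP)
  also have "\<dots> = (R ^^ Suc n) (fps_const X)"
    using right_comm_power_prime[OF p char', of P "fps_const X"] by (simp add: n R_def)
  finally have "fps_nth (fps_deriv (P ^ p)) i = fps_nth ((R ^^ Suc n) (fps_const X)) i" by simp
  hence "of_nat (Suc i) * shuffle_power X Y p (Suc i) = fps_nth ((R ^^ Suc n) (fps_const X)) i"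
    by (simp add: shuffle_power_def P_def)
  also have "fps_nth ((R ^^ m) (fps_const X)) i = (\<Sum>w\<in>words m i. fold D w X)" for m i
  proof (rule two_letter_expansion)
    show "additive (D b)" for b by standard (simp add: D_def algebra_simps)
    show "fps_nth ((R ^^ 0) (fps_const X)) i = (if i = 0 then X else 0)" for i by simp
    show "fps_nth ((R ^^ Suc m) (fps_const X)) i = (case i of 0 \<Rightarrow> 0 | Suc j \<Rightarrow> D True (fps_nth ((R ^^ m) (fps_const X)) j))
       + D False (fps_nth ((R ^^ m) (fps_const X)) i)" for m i
      by (simp add: R_def D_def P_def distrib_left distrib_right mult.assoc split: nat.splits flip: mult.assoc)
        (simp add: mult.assoc fps_mult_fps_X_commute)
  qed
  \<comment> \<open>The first commutator is taken with \<open>X\<close> itself: the letter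
    \<open>True\<close> gives 0 and \<open>False\<close> gives \<open>X * Y - Y * X\<close>. So
    \<open>n = p - 2\<close> free letters remain, as in \<open>symbol_words\<close>.\<close>
  also have "(\<Sum>w\<in>words (Suc n) i. fold D w X) = (\<Sum>w\<in>words n i. fold D w (X * Y - Y * X))"
  proof -
    have D0: "fold D w 0 = 0" for w by (induction w) (simp_all add: D_def)
    have "D True X = 0" "D False X = X * Y - Y * X" by (simp_all add: D_def)
    thus ?thesis by (simp add: sum_words_Cons D0 split: nat.splits)
  qed
  finally show ?thesis .
qed

lemma jacobson_power:
  fixes X Y :: "'r::ring_1"
  assumes "n > 0"
  shows "(X + Y) ^ n = X ^ n + Y ^ n + (\<Sum>i = 1..n - 1. shuffle_power X Y n i)"
proof -
  obtain m where n: "n = Suc m" using assms gr0_implies_Suc by blast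
  have "(\<Sum>i\<le>n. shuffle_power X Y n i) = (\<Sum>i\<in>{1..n - 1}. shuffle_power X Y n i) + shuffle_power X Y n 0 + shuffle_power X Y n n"
    unfolding n by (simp add: atMost_atLeast0 sum.atLeast_Suc_atMost[of 0 m] del: sum.atMost_Suc)
  thus ?thesis by (simp add: sum_shuffle_power shuffle_power_0 shuffle_power_self)
qed

lemmas linear_add = module_hom.add[OF module_hom_linearI]
lemmas linear_diff = module_hom.diff[OF module_hom_linearI]
lemmas linear_neg = module_hom.neg[OF module_hom_linearI]
lemmas linear_zero = module_hom.zero[OF module_hom_linearI]
lemmas linear_scale = module_hom.scale[OF module_hom_linearI]
lemmas linear_sum = module_hom.sum[OF module_hom_linearI]

section \<open>Symbol words as lists, and Jacobson's sum in a Lie algebra\<close>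

lemma sum_words_eq:
  fixes G :: "bool list \<Rightarrow> 'b::comm_monoid_add"
  shows "(\<Sum>v | length v = n. G v) = (\<Sum>i\<le>n. \<Sum>v\<in>words n i. G v)"
proof -
  have "{v :: bool list. length v = n} = (\<Union>i\<in>{..n}. words n i)"
    using count_le_length by (auto simp: words_def)
  moreover have "\<forall>i\<in>{..n}. \<forall>j\<in>{..n}. i \<noteq> j \<longrightarrow> words n i \<inter> words n j = {}" by (auto simp: words_def)
  ultimately show ?thesis by (simp add: sum.UNION_disjoint)
qed

text \<open>The list holds only the free letters at positions 3 to p, behind the two prescribed
  ones. The restriction to an interval puts the function into the extensional space used by
  \<open>symbol_words\<close>; positions start at 1 there, list indices at 0.\<close>

definition word_fun :: "bool list \<Rightarrow> nat \<Rightarrow> bool" where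
  "word_fun v = (\<lambda>i\<in>{1..length v + 2}. (True # False # v) ! (i - 1))"

lemma map_word_fun: "map (word_fun v) [1..<length v + 3] = True # False # v"
  by (rule nth_equalityI) (auto simp: word_fun_def nth_Cons split: nat.splits)

lemma sum_symbol_words_lists:
  fixes G :: "(nat \<Rightarrow> bool) \<Rightarrow> 'b::comm_monoid_add"
  shows "(\<Sum>w\<in>symbol_words (Suc (Suc n)). G w) = (\<Sum>v | length v = n. G (word_fun v))"
proof (rule sum.reindex_bij_witness[of _ word_fun "\<lambda>w. map w [3..<n + 3]"])
  fix w assume w: "w \<in> symbol_words (Suc (Suc n))"
  show "word_fun (map w [3..<n + 3]) = w"
  proof
    fix i
    show "word_fun (map w [3..<n + 3]) i = w i"
    proof (cases "i \<in> {1..Suc (Suc n)}")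
      case True
      have "(True # False # map w [3..<n + 3]) ! (i - 1) = w i"
      proof -
        consider "i = 1" | "i = 2" | "i \<ge> 3" using True by force
        thus ?thesis using w True
          by cases (auto simp: symbol_words_def nth_Cons')
      qed
      thus ?thesis using True by (simp add: word_fun_def)
    next
      case False
      thus ?thesis using w by (auto simp: word_fun_def symbol_words_def PiE_def extensional_def)
    qed
  qed
  thus "G (word_fun (map w [3..<n + 3])) = G w" by simp
next
  fix v :: "bool list" assume v: "v \<in> {v. length v = n}"
  show "map (word_fun v) [3..<n + 3] = v"
    using v by (auto intro!: nth_equalityI simp: word_fun_def)
  show "word_fun v \<in> symbol_words (Suc (Suc n))"
    using v by (auto simp: word_fun_def symbol_words_def)
qed auto

lemma num_first_word_fun: "num_first (length v + 2) (word_fun v) = Suc (count_list v True)"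
proof -
  have "num_first (length v + 2) (word_fun v) = length (filter (word_fun v) [1..<length v + 3])"
  proof -
    have "length (filter (word_fun v) [1..<length v + 3]) = card (set (filter (word_fun v) [1..<length v + 3]))"
      by (rule distinct_card[symmetric]) simp
    also have "set (filter (word_fun v) [1..<length v + 3]) = {i \<in> {1..length v + 2}. word_fun v i}" by auto
    finally show ?thesis by (simp add: num_first_def)
  qed
  also have "\<dots> = length (filter id (map (word_fun v) [1..<length v + 3]))"
    by (simp add: filter_map)
  also have "\<dots> = Suc (count_list v True)"
    unfolding map_word_fun by (induction v) auto
  finally show ?thesis .
qed

lemma ascending_word_fun:
  assumes "length v = n"
  shows "ascending (letter x y (word_fun v)) 2 (Suc (Suc n)) = y # map (\<lambda>b. if b then x else y) v"
proof -
  have "map (letter x y (word_fun v)) [1..<length v + 3] = map (\<lambda>b. if b then x else y) (map (word_fun v) [1..<length v + 3])"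
    by (simp add: letter_def)
  hence "map (letter x y (word_fun v)) [1..<length v + 3] = x # y # map (\<lambda>b. if b then x else y) v"
    unfolding map_word_fun by simp
  moreover have "[1..<length v + 3] = 1 # [2..<length v + 3]" by (simp add: upt_conv_Cons numeral_eq_Suc del: upt_Suc)
  ultimately show ?thesis using assms by (simp add: ascending_def eval_nat_numeral del: upt_Suc)
qed

lemma letter_word_fun_1: "letter x y (word_fun v) 1 = x"
  by (simp add: letter_def word_fun_def)

text \<open>Words are grouped by the number \<open>i\<close> of \<open>True\<close> among the free
  letters. The prescribed first letter raises the count to \<open>Suc i\<close>, the factor that
  also appears in \<open>jacobson_coefficient\<close>.\<close>

lemma sum_symbol_words:
  fixes G :: "(nat \<Rightarrow> bool) \<Rightarrow> 'v::ab_group_add" and s :: "'f::field \<Rightarrow> 'v \<Rightarrow> 'v"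
  assumes "vector_space s"
  shows "(\<Sum>w\<in>symbol_words (Suc (Suc n)). s (inverse (of_nat (num_first (Suc (Suc n)) w))) (G w)) =
    (\<Sum>i\<le>n. s (inverse (of_nat (Suc i))) (\<Sum>v\<in>words n i. G (word_fun v)))"
proof -
  interpret vector_space s by fact
  have "num_first (Suc (Suc n)) (word_fun v) = Suc i" if "v \<in> words n i" for v i
    using that num_first_word_fun[of v] by (auto simp: words_def)
  thus ?thesis unfolding sum_symbol_words_lists sum_words_eq scale_sum_right by (intro sum.cong) auto
qed

lemma ad_line_nth:
  assumes "lie_algebra L"
  shows "coeff (ad_line L x y q) i = (case i of 0 \<Rightarrow> 0 | Suc j \<Rightarrow> brk L x (coeff q j)) + brk L y (coeff q i)"
proof -
  have "brk L a 0 = 0" for a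
    using assms linear_zero unfolding lie_algebra_def by blast
  thus ?thesis by (auto simp: ad_line_def coeff_map_poly coeff_pCons split: nat.splits)
qed

text \<open>\<open>ad_line\<close> adds letters on the left of a bracket, \<open>brks\<close> on the
  right. Each swap costs a sign, and the \<open>Suc n\<close> signs cancel because \<open>n\<close>
  is odd. Words that begin with \<open>x\<close> drop out since the bracket of \<open>x\<close> with
  itself is 0.\<close>

lemma sum_jacobson_s:
  fixes L :: "('f::field, 'a::ab_group_add) restricted_lie"
  assumes L: "lie_algebra L" and p: "CHAR('f) = Suc (Suc n)" and odd: "odd n"
  shows "(\<Sum>i = 1..CHAR('f) - 1. jacobson_s L i x y) =
    (\<Sum>i\<le>n. scal L (inverse (of_nat (Suc i))) (\<Sum>v\<in>words n i. brks L x (y # map (\<lambda>b. if b then x else y) v)))"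
proof -
  have vs: "vector_space (scal L)"
    and lr: "\<And>x. Vector_Spaces.linear (scal L) (scal L) (\<lambda>y. brk L x y)"
    and ll: "\<And>y. Vector_Spaces.linear (scal L) (scal L) (\<lambda>x. brk L x y)"
    and alt: "\<And>x. brk L x x = 0"
    using L by (auto simp: lie_algebra_def)
  note add = linear_add[OF lr] linear_add[OF ll]
  have skew: "brk L a b = - brk L b a" for a b
    using alt[of "a + b"] unfolding add by (simp add: alt eq_neg_iff_add_eq_0 add.commute)
  define l where "l = (\<lambda>b. if b then x else y)"
  have fold: "fold (\<lambda>b. brk L (l b)) w q = (if even (length w) then brks L q (map l w) else - brks L q (map l w))" for w q
  proof (induction w rule: rev_induct)
    case (snoc b w)
    have "fold (\<lambda>b. brk L (l b)) (w @ [b]) q = - brk L (fold (\<lambda>b. brk L (l b)) w q) (l b)"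
      by (simp add: skew[of "l b"])
    thus ?case by (simp add: snoc brks_def linear_neg[OF ll])
  qed (simp add: brks_def)
  have brks0: "brks L 0 w = 0" for w
    by (induction w) (simp_all add: brks_def linear_zero[OF ll])
  have "coeff ((ad_line L x y ^^ m) [:x:]) i = (\<Sum>w\<in>words m i. fold (\<lambda>b. brk L (l b)) w x)" for m i
    by (rule two_letter_expansion[where Q = "\<lambda>m i. coeff ((ad_line L x y ^^ m) [:x:]) i" and D = "\<lambda>b. brk L (l b)"])
      (auto simp: l_def additive_def add ad_line_nth[OF L] coeff_pCons split: nat.splits)
  hence "coeff ((ad_line L x y ^^ Suc n) [:x:]) i = (\<Sum>w\<in>words (Suc n) i. brks L x (map l w))" for i
    using odd by (simp only: fold) (auto intro!: sum.cong simp: words_def)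
  moreover have "brks L x (x # u) = 0" for u using brks0[of u] by (simp add: brks_def alt)
  ultimately have "coeff ((ad_line L x y ^^ Suc n) [:x:]) i = (\<Sum>v\<in>words n i. brks L x (y # map l v))" for i
    by (simp add: sum_words_Cons l_def split: nat.splits)
  hence "jacobson_s L (Suc i) x y = scal L (inverse (of_nat (Suc i))) (\<Sum>v\<in>words n i. brks L x (y # map l v))" for i
    by (simp add: jacobson_s_def p del: funpow.simps)
  moreover have "(\<Sum>i = 1..CHAR('f) - 1. jacobson_s L i x y) = (\<Sum>i\<le>n. jacobson_s L (Suc i) x y)"
    by (rule sum.reindex_bij_witness[of _ Suc "\<lambda>i. i - 1"]) (auto simp: p)
  ultimately show ?thesis by (simp add: l_def)
qed

section \<open>The ring of additive endomorphisms of V \<oplus> F\<close>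

typedef (overloaded) ('v, 'f) prod_endo = "{f :: 'v::ab_group_add \<times> 'f::field \<Rightarrow> 'v \<times> 'f. additive f}"
  morphisms endo_app Endo
  by (rule exI[of _ id]) (simp add: additive_def)

setup_lifting type_definition_prod_endo

lemma additive_endo_app: "additive (endo_app f)"
  using endo_app[of f] by simp

lemma endo_eqI: "(\<And>u. endo_app f u = endo_app g u) \<Longrightarrow> f = g"
  by (intro endo_app_inject[THEN iffD1] ext)

text \<open>Jacobson's formula above holds in every \<open>ring_1\<close>, and this instance makes
  it available for operators. The factor F carries the vector \<open>(0, 1)\<close> at which they
  are evaluated; it also gives \<open>0 \<noteq> 1\<close> when V is zero.\<close>

instantiation prod_endo :: (ab_group_add, field) ring_1
begin

lift_definition zero_prod_endo :: "('a, 'b) prod_endo" is "\<lambda>x. 0" by (simp add: additive_def)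
lift_definition one_prod_endo :: "('a, 'b) prod_endo" is "\<lambda>x. x" by (simp add: additive_def)
lift_definition plus_prod_endo :: "('a, 'b) prod_endo \<Rightarrow> ('a, 'b) prod_endo \<Rightarrow> ('a, 'b) prod_endo"
  is "\<lambda>f g x. f x + g x" by (simp add: additive_def)
lift_definition minus_prod_endo :: "('a, 'b) prod_endo \<Rightarrow> ('a, 'b) prod_endo \<Rightarrow> ('a, 'b) prod_endo"
  is "\<lambda>f g x. f x - g x" by (simp add: additive_def)
lift_definition uminus_prod_endo :: "('a, 'b) prod_endo \<Rightarrow> ('a, 'b) prod_endo"
  is "\<lambda>f x. - f x" by (simp add: additive_def)
lift_definition times_prod_endo :: "('a, 'b) prod_endo \<Rightarrow> ('a, 'b) prod_endo \<Rightarrow> ('a, 'b) prod_endo"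
  is "\<lambda>f g x. f (g x)" by (simp add: additive_def del: split_paired_All)

instance
proof
  show "(0 :: ('a, 'b) prod_endo) \<noteq> 1"
    proof transfer
    show "(\<lambda>x :: 'a \<times> 'b. 0) \<noteq> (\<lambda>x. x)"
    proof
      assume "(\<lambda>x :: 'a \<times> 'b. 0) = (\<lambda>x. x)"
      from fun_cong[OF this, of "(0, 1)"] have "snd (0 :: 'a \<times> 'b) = snd ((0, 1) :: 'a \<times> 'b)" by (rule arg_cong)
      thus False by simp
    qed
  qed
qed (rule endo_eqI, simp add: zero_prod_endo.rep_eq one_prod_endo.rep_eq plus_prod_endo.rep_eq minus_prod_endo.rep_eq
    uminus_prod_endo.rep_eq times_prod_endo.rep_eq additive.add[OF additive_endo_app])+

end

lemma endo_app_simps [simp]: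
  "endo_app 0 u = 0" "endo_app 1 u = u" "endo_app (f + g) u = endo_app f u + endo_app g u"
  "endo_app (f - g) u = endo_app f u - endo_app g u" "endo_app (- f) u = - endo_app f u"
  "endo_app (f * g) u = endo_app f (endo_app g u)"
  by (simp_all add: zero_prod_endo.rep_eq one_prod_endo.rep_eq plus_prod_endo.rep_eq minus_prod_endo.rep_eq
      uminus_prod_endo.rep_eq times_prod_endo.rep_eq)

lemma endo_app_sum: "endo_app (\<Sum>i\<in>I. f i) u = (\<Sum>i\<in>I. endo_app (f i) u)"
  by (induction I rule: infinite_finite_induct) auto

lemma endo_app_of_nat:
  assumes "vector_space s"
  shows "endo_app (of_nat n) (v, c) = (s (of_nat n) v, of_nat n * c)"
proof -
  interpret vector_space s by fact
  show ?thesis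
    by (induction n) (simp_all add: zero_prod_def scale_left_distrib distrib_right)
qed

text \<open>The ring consists of maps that are merely additive, but \<open>of_nat m\<close> still
  acts as the scalar \<open>m\<close>, so the characteristic of the field passes to it.\<close>

lemma of_nat_CHAR_prod_endo:
  assumes "vector_space (s :: 'f::field \<Rightarrow> 'v::ab_group_add \<Rightarrow> 'v)"
  shows "of_nat CHAR('f) = (0 :: ('v, 'f) prod_endo)"
proof -
  interpret vector_space s by fact
  have "endo_app (of_nat CHAR('f)) u = endo_app (0 :: ('v, 'f) prod_endo) u" for u
    by (cases u) (simp add: endo_app_of_nat[OF assms] zero_prod_def)
  thus ?thesis by (rule endo_eqI)
qed

section \<open>The star property of the first induced map\<close>

text \<open>The inner sum of \<open>star_sum\<close> with an arbitrary word length \<open>n\<close>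
  in place of p, which allows recursion on \<open>n\<close>.\<close>

definition star_inner ::
  "('f::field, 'a::ab_group_add) restricted_lie \<Rightarrow> ('f \<Rightarrow> 'v::ab_group_add \<Rightarrow> 'v) \<Rightarrow> ('a \<Rightarrow> 'v \<Rightarrow> 'v) \<Rightarrow>
   ('a \<Rightarrow> 'a \<Rightarrow> 'v) \<Rightarrow> (nat \<Rightarrow> 'a) \<Rightarrow> nat \<Rightarrow> 'v"
where
  "star_inner L s act \<psi> h n = (\<Sum>k = 0..n - 2. s ((- 1) ^ k)
     (acts act (descending h n (n - k + 1))
       (\<psi> (brks L (h 1) (ascending h 2 (n - k - 1))) (h (n - k)))))"

lemma star_inner_2:
  assumes "vector_space s"
  shows "star_inner L s act \<psi> h 2 = \<psi> (h 1) (h 2)"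
proof -
  interpret vector_space s by fact
  show ?thesis by (simp add: star_inner_def acts_def descending_def brks_def ascending_def)
qed

text \<open>In each summand with \<open>k > 0\<close> the letter \<open>h (Suc n)\<close> is the
  outermost operator; removing it lowers \<open>k\<close> by one and flips the sign. The summand
  \<open>k = 0\<close> stands alone.\<close>

lemma star_inner_Suc:
  assumes "vector_space s" and act: "\<And>x. Vector_Spaces.linear s s (act x)" and "n \<ge> 2"
  shows "star_inner L s act \<psi> h (Suc n) =
    \<psi> (brks L (h 1) (ascending h 2 n)) (h (Suc n)) - act (h (Suc n)) (star_inner L s act \<psi> h n)"
proof -
  interpret vector_space s by fact
  obtain m where n: "n = m + 2" using assms(3) le_Suc_ex by (metis add.commute)
  define t where "t = (\<lambda>n k. acts act (descending h n (n - k + 1))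
       (\<psi> (brks L (h 1) (ascending h 2 (n - k - 1))) (h (n - k))))"
  have t0: "t (Suc n) 0 = \<psi> (brks L (h 1) (ascending h 2 n)) (h (Suc n))"
    by (simp add: t_def acts_def descending_def)
  have tS: "t (Suc n) (Suc k) = act (h (Suc n)) (t n k)" if "k \<le> m" for k
  proof -
    have "[n - k + 1..<Suc (Suc n)] = [n - k + 1..<Suc n] @ [Suc n]" using that n by simp
    thus ?thesis by (simp add: t_def acts_def descending_def del: upt_Suc)
  qed
  have "star_inner L s act \<psi> h (Suc n) = (\<Sum>k\<le>Suc m. s ((- 1) ^ k) (t (Suc n) k))"
    by (simp add: star_inner_def t_def n atMost_atLeast0 del: sum.cl_ivl_Suc)
  also have "\<dots> = t (Suc n) 0 + (\<Sum>k\<le>m. s ((- 1) ^ Suc k) (t (Suc n) (Suc k)))"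
    by (subst sum.atMost_Suc_shift) simp
  also have "(\<Sum>k\<le>m. s ((- 1) ^ Suc k) (t (Suc n) (Suc k))) = - act (h (Suc n)) (\<Sum>k\<le>m. s ((- 1) ^ k) (t n k))"
    by (simp add: tS linear_sum[OF act] linear_scale[OF act] sum_negf)
  also have "(\<Sum>k\<le>m. s ((- 1) ^ k) (t n k)) = star_inner L s act \<psi> h n"
    by (simp add: star_inner_def t_def n atMost_atLeast0)
  finally show ?thesis by (simp add: t0)
qed

lemma star_sum_eq:
  fixes L :: "('f::field, 'a::ab_group_add) restricted_lie"
  assumes "vector_space s" and "CHAR('f) = Suc (Suc n)"
  shows "star_sum L s act \<psi> x y = (\<Sum>i\<le>n. s (inverse (of_nat (Suc i)))
    (\<Sum>v\<in>words n i. star_inner L s act \<psi> (letter x y (word_fun v)) CHAR('f)))"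
  using sum_symbol_words[OF assms(1), where n = n and G = "\<lambda>w. star_inner L s act \<psi> (letter x y w) CHAR('f)"]
  by (simp add: star_sum_def star_inner_def Let_def assms(2))

text \<open>The axioms are only required on a subspace \<open>V\<close> since \<open>hom_act\<close> below satisfies them for linear
  maps but not for arbitrary functions.\<close>

locale lie_rep =
  fixes L :: "('f::field, 'a::ab_group_add) restricted_lie"
    and s :: "'f \<Rightarrow> 'v::ab_group_add \<Rightarrow> 'v"
    and act :: "'a \<Rightarrow> 'v \<Rightarrow> 'v"
    and V :: "'v set"
  assumes char: "CHAR('f) \<ge> 3"
    and L: "restricted_lie_algebra L"
    and vs: "vector_space s"
    and act_linear: "Vector_Spaces.linear s s (act x)"
    and subspace_V: "module.subspace s V"
    and act_V: "v \<in> V \<Longrightarrow> act x v \<in> V"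
    and act_linear_left: "v \<in> V \<Longrightarrow> Vector_Spaces.linear (scal L) s (\<lambda>x. act x v)"
    and act_brk: "v \<in> V \<Longrightarrow> act (brk L x y) v = act x (act y v) - act y (act x v)"
begin

lemma lie: "lie_algebra L"
  using L by (simp add: restricted_lie_algebra_def)

lemma vector_space_L: "vector_space (scal L)"
  using lie by (simp add: lie_algebra_def)

lemma prime_char: "prime CHAR('f)"
  using char by (intro prime_CHAR_semidom) simp

lemma char_eq:
  obtains n where "CHAR('f) = Suc (Suc n)" "odd n"
proof -
  have "odd CHAR('f)" using prime_odd_nat[OF prime_char] char by simp
  moreover have "CHAR('f) = Suc (Suc (CHAR('f) - 2))" using char by simp
  ultimately show ?thesis using that[of "CHAR('f) - 2"] by (metis even_Suc)
qed

lemma pmap_scale: "pmap L (scal L c x) = scal L (c ^ CHAR('f)) (pmap L x)"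
  using L unfolding restricted_lie_algebra_def by blast

lemma V_closed: "u \<in> V \<Longrightarrow> v \<in> V \<Longrightarrow> u + v \<in> V" "v \<in> V \<Longrightarrow> s c v \<in> V" "0 \<in> V"
  "u \<in> V \<Longrightarrow> v \<in> V \<Longrightarrow> u - v \<in> V" "v \<in> V \<Longrightarrow> - v \<in> V"
proof -
  interpret vector_space s by (fact vs)
  note closed = subspace_add[OF subspace_V] subspace_scale[OF subspace_V] subspace_0[OF subspace_V]
    subspace_diff[OF subspace_V] subspace_neg[OF subspace_V]
  show "u \<in> V \<Longrightarrow> v \<in> V \<Longrightarrow> u + v \<in> V" "v \<in> V \<Longrightarrow> s c v \<in> V" "0 \<in> V"
    "u \<in> V \<Longrightarrow> v \<in> V \<Longrightarrow> u - v \<in> V" "v \<in> V \<Longrightarrow> - v \<in> V"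
    by (simp_all add: closed)
qed

lemma act_power_V: "v \<in> V \<Longrightarrow> (act x ^^ n) v \<in> V"
  by (induction n) (simp_all add: act_V)

lemma act_power_linear: "Vector_Spaces.linear s s (act x ^^ n)"
proof (induction n)
  case 0
  interpret vector_space s by (fact vs)
  show ?case using linear_id by (simp add: id_def)
next
  case (Suc n)
  show ?case using Vector_Spaces.linear_compose[OF Suc act_linear] by (simp add: o_def)
qed

lemma act_power_scale:
  assumes "v \<in> V"
  shows "(act (scal L c x) ^^ n) v = s (c ^ n) ((act x ^^ n) v)"
proof (induction n)
  case 0
  interpret vector_space s by (fact vs)
  show ?case by simp
next
  case (Suc n)
  interpret vector_space s by (fact vs)
  show ?case
    by (simp add: Suc linear_scale[OF act_linear] linear_scale[OF act_linear_left[OF act_power_V[OF assms]]]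
        mult.commute)
qed

definition aff :: "('a \<Rightarrow> 'v) \<Rightarrow> 'a \<Rightarrow> ('v, 'f) prod_endo" where
  "aff \<psi> x = Endo (\<lambda>(v, c). (act x v + s c (\<psi> x), 0))"

lemma endo_app_aff: "endo_app (aff \<psi> x) (v, c) = (act x v + s c (\<psi> x), 0)"
proof -
  interpret vector_space s by (fact vs)
  have "additive (\<lambda>(v, c). (act x v + s c (\<psi> x), 0 :: 'f))"
    by (auto simp: additive_def linear_add[OF act_linear] scale_left_distrib)
  thus ?thesis by (simp add: aff_def Endo_inverse)
qed

context
  fixes \<psi> :: "'a \<Rightarrow> 'v"
  assumes \<psi>: "Vector_Spaces.linear (scal L) s \<psi>" and \<psi>_V: "\<psi> x \<in> V"
begin

text \<open>After one factor the scalar coordinate is 0 and only the action is left. With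
  \<open>Suc n = p\<close> the second equation produces the action term of
  \<open>ind1\<close>.\<close>

lemma aff_power: "endo_app (aff \<psi> x ^ n) (v, 0) = ((act x ^^ n) v, 0)"
  "endo_app (aff \<psi> x ^ Suc n) (0, 1) = ((act x ^^ n) (\<psi> x), 0)"
proof -
  interpret vector_space s by (fact vs)
  show *: "endo_app (aff \<psi> x ^ n) (v, 0) = ((act x ^^ n) v, 0)" for v
    by (induction n) (simp_all add: endo_app_aff)
  show "endo_app (aff \<psi> x ^ Suc n) (0, 1) = ((act x ^^ n) (\<psi> x), 0)"
    by (simp only: power_Suc2 endo_app_simps endo_app_aff) (simp add: * linear_zero[OF act_linear])
qed

text \<open>\<open>act\<close> is assumed additive in its first argument only on vectors of
  \<open>V\<close>. So \<open>aff \<psi> x + aff \<psi> y\<close> and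
  \<open>aff \<psi> (x + y)\<close> are compared on \<open>(v, 0)\<close> with
  \<open>v \<in> V\<close> and on \<open>(0, 1)\<close>, not as operators.\<close>

lemma aff_add_power: "v \<in> V \<Longrightarrow> endo_app ((aff \<psi> x + aff \<psi> y) ^ n) (v, 0) = ((act (x + y) ^^ n) v, 0)"
  "endo_app ((aff \<psi> x + aff \<psi> y) ^ Suc n) (0, 1) = ((act (x + y) ^^ n) (\<psi> (x + y)), 0)"
proof -
  interpret vector_space s by (fact vs)
  show *: "endo_app ((aff \<psi> x + aff \<psi> y) ^ n) (v, 0) = ((act (x + y) ^^ n) v, 0)" if "v \<in> V" for v
    by (induction n) (simp_all add: endo_app_aff linear_add[OF act_linear_left] that act_power_V)
  show "endo_app ((aff \<psi> x + aff \<psi> y) ^ Suc n) (0, 1) = ((act (x + y) ^^ n) (\<psi> (x + y)), 0)"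
    using *[OF \<psi>_V, of "x + y"]
    by (simp only: power_Suc2 endo_app_simps endo_app_aff) (simp add: linear_zero[OF act_linear] linear_add[OF \<psi>])
qed

abbreviation aff_comm :: "'a \<Rightarrow> ('v, 'f) prod_endo \<Rightarrow> ('v, 'f) prod_endo" where
  "aff_comm a \<equiv> \<lambda>u. u * aff \<psi> a - aff \<psi> a * u"

lemma aff_comm_V:
  assumes "v \<in> V"
  shows "endo_app (fold aff_comm as (aff \<psi> a)) (v, 0) = (act (brks L a as) v, 0)"
  using assms
proof (induction as arbitrary: v rule: rev_induct)
  case Nil
  interpret vector_space s by (fact vs)
  show ?case by (simp add: endo_app_aff brks_def)
next
  case (snoc b as)
  interpret vector_space s by (fact vs)
  show ?case using snoc by (simp add: endo_app_aff act_V brks_def act_brk)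
qed

text \<open>On \<open>(0, 1)\<close> the commutators of the operators \<open>aff \<psi> (h i)\<close> satisfy the recursion that
  \<open>star_inner_Suc\<close> gives for the coboundary of \<open>\<psi>\<close>.\<close>

lemma aff_comm_unit:
  assumes "n \<ge> 2"
  shows "endo_app (fold aff_comm (ascending h 2 n) (aff \<psi> (h 1))) (0, 1) =
    (star_inner L s act (dCE1 L act \<psi>) h n + \<psi> (brks L (h 1) (ascending h 2 n)), 0)"
  using assms
proof (induction n rule: dec_induct)
  case base
  interpret vector_space s by (fact vs)
  show ?case
    by (simp add: star_inner_2[OF vs] ascending_def brks_def dCE1_def endo_app_aff linear_zero[OF act_linear])
next
  case (step n)
  interpret vector_space s by (fact vs)
  have asc: "ascending h 2 (Suc n) = ascending h 2 n @ [h (Suc n)]"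
    using step by (simp add: ascending_def)
  \<comment> \<open>Let b be the iterated bracket of length \<open>n\<close> and h the new letter.
    On \<open>(0, 1)\<close> the new commutator gives b.\<psi>(h) - h.\<psi>(b), which is the
    coboundary of \<psi> at (b, h) plus \<psi>([b, h]), and further -h applied to the old
    \<open>star_inner\<close>.\<close>
  show ?case
    unfolding star_inner_Suc[OF vs act_linear step(1)] asc
    by (simp add: step.IH[unfolded One_nat_def] endo_app_aff aff_comm_V \<psi>_V linear_zero[OF act_linear] linear_add[OF act_linear] brks_def dCE1_def)
qed

text \<open>Jacobson's formula for \<open>X + Y\<close> is evaluated at \<open>(0, 1)\<close>. The
  p-th powers give the action terms of \<open>ind1\<close>. By \<open>aff_comm_unit\<close> the
  mixed terms give \<open>star_sum\<close> plus \<psi> of the sum of the \<open>jacobson_s\<close>,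
  and the latter is what \<psi> of the p-map of \<open>x + y\<close> contributes.\<close>

lemma ind1_add:
  "ind1 L act \<psi> (x + y) = ind1 L act \<psi> x + ind1 L act \<psi> y + star_sum L s act (dCE1 L act \<psi>) x y"
proof -
  interpret vector_space s by (fact vs)
  obtain n where p: "CHAR('f) = Suc (Suc n)" and n: "odd n" using char_eq by blast
  define X Y where "X = aff \<psi> x" and "Y = aff \<psi> y"
  let ?E = "\<lambda>i. fst (endo_app (shuffle_power X Y CHAR('f) i) (0, 1))"
  let ?l = "\<lambda>b. if b then x else y"
  \<comment> \<open>A natural number in the operator ring becomes a field scalar, by which one can
    divide.\<close>
  have comm: "fst (endo_app (of_nat m * u) (0, 1)) = s (of_nat m) (fst (endo_app u (0, 1)))" for m and u :: "('v, 'f) prod_endo"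
    by (cases "endo_app u (0, 1)") (simp add: endo_app_of_nat[OF vs])
  have inner: "star_inner L s act (dCE1 L act \<psi>) (letter x y (word_fun v)) CHAR('f) =
      fst (endo_app (fold (\<lambda>b u. u * (if b then X else Y) - (if b then X else Y) * u) v (X * Y - Y * X)) (0, 1))
      - \<psi> (brks L x (y # map ?l v))" if "length v = n" for v
  proof -
    have "fold aff_comm (y # map ?l v) (aff \<psi> x) =
      fold (\<lambda>b u. u * (if b then X else Y) - (if b then X else Y) * u) v (X * Y - Y * X)"
    proof -
      have "aff \<psi> (?l b) = (if b then aff \<psi> x else aff \<psi> y)" for b by simp
      thus ?thesis by (simp only: fold_map o_def X_def Y_def list.map fold_simps)
    qed
    thus ?thesis
      using aff_comm_unit[where n = "CHAR('f)" and h = "letter x y (word_fun v)"] char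
      by (simp add: p ascending_word_fun[OF that] letter_word_fun_1[unfolded One_nat_def])
  qed
  have "star_sum L s act (dCE1 L act \<psi>) x y =
     (\<Sum>i\<le>n. ?E (Suc i)) - \<psi> (\<Sum>i = 1..CHAR('f) - 1. jacobson_s L i x y)"
  proof -
    have "s (inverse (of_nat (Suc i))) (\<Sum>v\<in>words n i. star_inner L s act (dCE1 L act \<psi>) (letter x y (word_fun v)) CHAR('f))
      = ?E (Suc i) - \<psi> (scal L (inverse (of_nat (Suc i))) (\<Sum>v\<in>words n i. brks L x (y # map ?l v)))"
      if "i \<le> n" for i
    proof -
      \<comment> \<open>\<open>Suc i\<close> is at most \<open>p - 1\<close>, so the coefficient
        given by \<open>jacobson_coefficient\<close> can be divided by it.\<close>
      have "(of_nat (Suc i) :: 'f) \<noteq> 0"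
        unfolding of_nat_eq_0_iff_char_dvd using that p by (auto dest: dvd_imp_le)
      moreover have "(\<Sum>v\<in>words n i. star_inner L s act (dCE1 L act \<psi>) (letter x y (word_fun v)) CHAR('f)) =
         fst (endo_app (of_nat (Suc i) * shuffle_power X Y CHAR('f) (Suc i)) (0, 1)) - \<psi> (\<Sum>v\<in>words n i. brks L x (y # map ?l v))"
        unfolding jacobson_coefficient[OF prime_char of_nat_CHAR_prod_endo[OF vs] p]
        by (simp add: endo_app_sum fst_sum linear_sum[OF \<psi>] inner words_def flip: sum_subtractf)
      ultimately show ?thesis by (simp only: comm linear_scale[OF \<psi>] scale_right_diff_distrib) simp
    qed
    thus ?thesis unfolding star_sum_eq[OF vs p] sum_jacobson_s[OF lie p n] by (simp add: linear_sum[OF \<psi>] sum_subtractf)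
  qed
  moreover have "(\<Sum>i\<le>n. ?E (Suc i)) = (\<Sum>i = 1..CHAR('f) - 1. ?E i)"
    by (rule sum.reindex_bij_witness[of _ "\<lambda>i. i - 1" Suc]) (auto simp: p)
  moreover have "fst (endo_app ((X + Y) ^ CHAR('f)) (0, 1)) = fst (endo_app (X ^ CHAR('f)) (0, 1))
     + fst (endo_app (Y ^ CHAR('f)) (0, 1)) + (\<Sum>i = 1..CHAR('f) - 1. ?E i)"
    using jacobson_power[of "CHAR('f)" X Y] by (simp add: p endo_app_sum fst_sum)
  ultimately have "star_sum L s act (dCE1 L act \<psi>) x y = (act (x + y) ^^ Suc n) (\<psi> (x + y)) - (act x ^^ Suc n) (\<psi> x)
     - (act y ^^ Suc n) (\<psi> y) - \<psi> (\<Sum>i = 1..CHAR('f) - 1. jacobson_s L i x y)"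
    by (simp add: p X_def Y_def aff_power aff_add_power del: power_Suc funpow.simps)
  moreover have "pmap L (x + y) = pmap L x + pmap L y + (\<Sum>i = 1..CHAR('f) - 1. jacobson_s L i x y)"
    using L unfolding restricted_lie_algebra_def by blast
  ultimately show ?thesis
    by (simp add: ind1_def p linear_add[OF \<psi>] del: funpow.simps)
qed

lemma ind1_scale: "ind1 L act \<psi> (scal L c x) = s (c ^ CHAR('f)) (ind1 L act \<psi> x)"
proof -
  interpret vector_space s by (fact vs)
  obtain n where p: "CHAR('f) = Suc (Suc n)" using char_eq by blast
  show ?thesis
    by (simp add: ind1_def pmap_scale linear_scale[OF \<psi>] act_power_scale[OF V_closed(2)] \<psi>_V
        act_power_scale[OF \<psi>_V] linear_scale[OF act_power_linear] scale_right_diff_distrib p del: funpow.simps)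
qed

lemma ind1_V: "ind1 L act \<psi> x \<in> V"
  by (simp add: ind1_def V_closed act_power_V \<psi>_V)

theorem ind1_star: "star_property L s act (dCE1 L act \<psi>) (ind1 L act \<psi>)"
  by (simp add: star_property_def ind1_add ind1_scale)

end

end

section \<open>Maps from a Lie algebra to a module\<close>

lemma linearI:
  assumes "vector_space s1" "vector_space s2"
    and "\<And>x y. f (x + y) = f x + f y" and "\<And>c x. f (s1 c x) = s2 c (f x)"
  shows "Vector_Spaces.linear s1 s2 f"
  using assms by (simp add: linear_iff_module_hom module_hom_iff module_iff_vector_space)

definition hom_scale :: "('f \<Rightarrow> 'v \<Rightarrow> 'v) \<Rightarrow> 'f \<Rightarrow> ('a \<Rightarrow> 'v) \<Rightarrow> 'a \<Rightarrow> 'v" where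
  "hom_scale s c f = (\<lambda>x. s c (f x))"

text \<open>As \<open>[x, y] = - ad y x\<close>, this is the usual action on \<open>Hom(L, V)\<close>.\<close>

definition hom_act :: "('f, 'a) restricted_lie \<Rightarrow> ('a \<Rightarrow> 'v::plus \<Rightarrow> 'v) \<Rightarrow> 'a \<Rightarrow> ('a \<Rightarrow> 'v) \<Rightarrow> 'a \<Rightarrow> 'v" where
  "hom_act L act y f = (\<lambda>x. act y (f x) + f (brk L x y))"

lemma vector_space_hom_scale:
  assumes "vector_space s"
  shows "vector_space (hom_scale s)"
proof -
  interpret vector_space s by fact
  show ?thesis
    by unfold_locales (simp_all add: hom_scale_def fun_eq_iff scale_right_distrib scale_left_distrib)
qed

lemma hom_act_linear:
  assumes "Vector_Spaces.linear s s (act y)"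
  shows "Vector_Spaces.linear (hom_scale s) (hom_scale s) (hom_act L act y)"
proof -
  interpret Vector_Spaces.linear s s "act y" by fact
  have vs: "vector_space s" by unfold_locales
  show ?thesis
    by (intro linearI vector_space_hom_scale vs)
      (simp_all add: hom_act_def hom_scale_def fun_eq_iff add scale vs1.scale_right_distrib)
qed

text \<open>Composing \<open>f\<close> with \<open>act y\<close> on the left and with bracketing by
  \<open>y\<close> on the right are commuting operations; this is the binomial theorem for their
  sum.\<close>

lemma hom_act_power:
  assumes "Vector_Spaces.linear s s (act y)"
  shows "(hom_act L act y ^^ n) f x =
    (\<Sum>k\<le>n. s (of_nat (n choose k)) ((act y ^^ k) (f (((\<lambda>u. brk L u y) ^^ (n - k)) x))))"
proof (induction n arbitrary: x)
  case 0
  interpret Vector_Spaces.linear s s "act y" by fact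
  show ?case by simp
next
  case (Suc n)
  interpret Vector_Spaces.linear s s "act y" by fact
  let ?t = "\<lambda>c k l. s (of_nat c) ((act y ^^ k) (f (((\<lambda>u. brk L u y) ^^ l) x)))"
  have "(hom_act L act y ^^ Suc n) f x = (\<Sum>k\<le>n. ?t (n choose k) (Suc k) (n - k)) + (\<Sum>k\<le>n. ?t (n choose k) k (Suc n - k))"
  proof -
    have "((\<lambda>u. brk L u y) ^^ (n - k)) (brk L x y) = ((\<lambda>u. brk L u y) ^^ (Suc n - k)) x" if "k \<le> n" for k
      using that funpow_swap1[of "\<lambda>u. brk L u y" "n - k" x] by (simp add: Suc_diff_le)
    thus ?thesis by (simp add: hom_act_def Suc.IH sum scale)
  qed
  also have "(\<Sum>k\<le>n. ?t (n choose k) k (Suc n - k)) = (\<Sum>k\<le>Suc n. ?t (n choose k) k (Suc n - k))"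
    by (simp add: binomial_eq_0)
  also have "\<dots> = ?t 1 0 (Suc n) + (\<Sum>k\<le>n. ?t (n choose Suc k) (Suc k) (n - k))"
    by (subst sum.atMost_Suc_shift) simp
  also have "(\<Sum>k\<le>n. ?t (n choose k) (Suc k) (n - k)) + \<dots> = ?t 1 0 (Suc n) + (\<Sum>k\<le>n. ?t (Suc n choose Suc k) (Suc k) (n - k))"
    by (simp add: sum.distrib vs1.scale_left_distrib)
  also have "\<dots> = (\<Sum>k\<le>Suc n. ?t (Suc n choose k) k (Suc n - k))"
    by (subst sum.atMost_Suc_shift) simp
  finally show ?case .
qed

section \<open>The double star sum as a star sum in Hom(L, V)\<close>

lemma sum_lists_insert:
  fixes G :: "bool list \<Rightarrow> 'b::comm_monoid_add"
  assumes "k \<le> j"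
  shows "(\<Sum>c | length c = Suc j. G c) = (\<Sum>b\<in>UNIV. \<Sum>c | length c = j. G (take k c @ b # drop k c))"
  unfolding sum.cartesian_product
proof (rule sum.reindex_bij_witness[of _ "\<lambda>(b, c). take k c @ b # drop k c" "\<lambda>c. (c ! k, take k c @ drop (Suc k) c)"])
  fix c :: "bool list" assume c: "c \<in> {c. length c = Suc j}"
  have *: "take k c @ c ! k # drop (Suc k) c = c" using c assms by (simp add: id_take_nth_drop[symmetric])
  show "(case (c ! k, take k c @ drop (Suc k) c) of (b, c) \<Rightarrow> take k c @ b # drop k c) = c"
    using c assms * by (simp add: min_def)
  thus "(case (c ! k, take k c @ drop (Suc k) c) of (b, c) \<Rightarrow> G (take k c @ b # drop k c)) = G c" by simp
  show "(c ! k, take k c @ drop (Suc k) c) \<in> UNIV \<times> {c. length c = j}" using c assms by simp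
next
  fix u :: "bool \<times> bool list" assume "u \<in> UNIV \<times> {c. length c = j}"
  thus "((case u of (b, c) \<Rightarrow> take k c @ b # drop k c) ! k,
      take k (case u of (b, c) \<Rightarrow> take k c @ b # drop k c) @ drop (Suc k) (case u of (b, c) \<Rightarrow> take k c @ b # drop k c)) = u"
    "(case u of (b, c) \<Rightarrow> take k c @ b # drop k c) \<in> {c. length c = Suc j}"
    using assms by (auto simp: nth_append min_absorb2)
qed

text \<open>Operators given by \<open>descending\<close> read the last \<open>j\<close> letters
  backwards. Writing that block as \<open>rev c\<close> lets \<open>c\<close> be read forwards,
  while \<open>d\<close> stays for the arguments of the cochain.\<close>

lemma sum_lists_append_rev:
  fixes G :: "bool list \<Rightarrow> 'b::comm_monoid_add"
  assumes "j \<le> n"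
  shows "(\<Sum>v | length v = n. G v) = (\<Sum>d | length d = n - j. \<Sum>c | length c = j. G (d @ rev c))"
  unfolding sum.cartesian_product
  by (rule sum.reindex_bij_witness[of _ "\<lambda>(d, c). d @ rev c" "\<lambda>v. (take (n - j) v, rev (drop (n - j) v))"])
    (use assms in auto)

lemma acts_linear:
  assumes "\<And>x. Vector_Spaces.linear s s (act x)" and "vector_space s"
  shows "Vector_Spaces.linear s s (acts act bs)"
proof (induction bs)
  case Nil
  interpret vector_space s by fact
  show ?case using linear_id by (simp add: acts_def id_def)
next
  case (Cons b bs)
  show ?case using Vector_Spaces.linear_compose[OF Cons assms(1)] by (simp add: acts_def o_def)
qed

text \<open>A product of operators \<open>hom_act\<close> expands into a sum over subsets of the word; summing over all
  words, only the size \<open>k\<close> of the subset matters, whence the binomial coefficients.\<close>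

lemma sum_acts_hom_act:
  fixes f :: "nat \<Rightarrow> 'a::ab_group_add \<Rightarrow> 'v::ab_group_add" and l :: "bool \<Rightarrow> 'a"
  assumes lin: "\<And>x. Vector_Spaces.linear s s (act x)"
  shows "(\<Sum>c | length c = j. acts (hom_act L act) (map l c) (f (count_list c True)) x) =
    (\<Sum>k\<le>j. s (of_nat (j choose k)) (\<Sum>c | length c = j.
      acts act (take k (map l c)) (f (count_list c True) (brks L x (drop k (map l c))))))"
proof (induction j arbitrary: x f)
  case 0
  interpret Vector_Spaces.linear s s "act 0" by fact
  show ?case by (simp add: acts_def brks_def)
next
  case (Suc j)
  interpret Vector_Spaces.linear s s "act 0" by fact
  define S where "S = (\<lambda>j k (f :: nat \<Rightarrow> 'a \<Rightarrow> 'v) x. \<Sum>c | length c = j.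
      acts act (take k (map l c)) (f (count_list c True) (brks L x (drop k (map l c)))))"
  \<comment> \<open>\<open>g b\<close> keeps in the counter a first letter \<open>b\<close> that has
    been split off.\<close>
  define g where "g = (\<lambda>b m. f (if b then Suc m else m))"
  have IH: "(\<Sum>c | length c = j. acts (hom_act L act) (map l c) (f (count_list c True)) x) = (\<Sum>k\<le>j. s (of_nat (j choose k)) (S j k f x))" for f x
    using Suc.IH by (simp add: S_def)
  have act_S: "(\<Sum>b\<in>UNIV. act (l b) (S j k (g b) x)) = S (Suc j) (Suc k) f x" for k
    unfolding S_def sum_lists_insert[OF le0] by (simp add: linear_sum[OF lin] acts_def g_def UNIV_bool)
  \<comment> \<open>A first letter that goes into the bracket is bracketed with \<open>x\<close>
    before all later ones. Reinserting it behind the \<open>k\<close> acting letters respects that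
    order, and \<open>f\<close> depends only on the total count, so the sum again runs over all
    words of length \<open>Suc j\<close>.\<close>
  have brk_S: "(\<Sum>b\<in>UNIV. S j k (g b) (brk L x (l b))) = S (Suc j) k f x" if "k \<le> j" for k
  proof -
    have "count_list (take k c) True + count_list (drop k c) True = count_list c True" for c :: "bool list"
      by (simp flip: count_list_append)
    thus ?thesis
      unfolding S_def sum_lists_insert[OF that]
      using that by (intro sum.cong refl) (auto simp: acts_def g_def brks_def min_absorb2 take_map drop_map)
  qed
  have "(\<Sum>c | length c = Suc j. acts (hom_act L act) (map l c) (f (count_list c True)) x) =
    (\<Sum>b\<in>UNIV. act (l b) (\<Sum>c | length c = j. acts (hom_act L act) (map l c) (g b (count_list c True)) x)
       + (\<Sum>c | length c = j. acts (hom_act L act) (map l c) (g b (count_list c True)) (brk L x (l b))))"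
    unfolding sum_lists_insert[OF le0] by (simp add: acts_def hom_act_def g_def linear_sum[OF lin] sum.distrib UNIV_bool)
  also have "\<dots> = (\<Sum>k\<le>j. s (of_nat (j choose k)) (\<Sum>b\<in>UNIV. act (l b) (S j k (g b) x)))
     + (\<Sum>k\<le>j. s (of_nat (j choose k)) (\<Sum>b\<in>UNIV. S j k (g b) (brk L x (l b))))"
    unfolding IH by (simp add: linear_sum[OF lin] linear_scale[OF lin] UNIV_bool vs1.scale_right_distrib sum.distrib)
  also have "\<dots> = (\<Sum>k\<le>j. s (of_nat (j choose k)) (S (Suc j) (Suc k) f x)) + (\<Sum>k\<le>j. s (of_nat (j choose k)) (S (Suc j) k f x))"
    by (simp add: act_S brk_S)
  also have "(\<Sum>k\<le>j. s (of_nat (j choose k)) (S (Suc j) k f x)) = (\<Sum>k\<le>Suc j. s (of_nat (j choose k)) (S (Suc j) k f x))"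
    by (simp add: binomial_eq_0)
  also have "\<dots> = S (Suc j) 0 f x + (\<Sum>k\<le>j. s (of_nat (j choose Suc k)) (S (Suc j) (Suc k) f x))"
    by (subst sum.atMost_Suc_shift) simp
  also have "(\<Sum>k\<le>j. s (of_nat (j choose k)) (S (Suc j) (Suc k) f x)) + \<dots> =
    S (Suc j) 0 f x + (\<Sum>k\<le>j. s (of_nat (Suc j choose Suc k)) (S (Suc j) (Suc k) f x))"
    by (simp add: sum.distrib vs1.scale_left_distrib)
  also have "\<dots> = (\<Sum>k\<le>Suc j. s (of_nat (Suc j choose k)) (S (Suc j) k f x))"
    by (subst sum.atMost_Suc_shift) simp
  finally show ?case unfolding S_def .
qed

text \<open>Read downwards from the end, the word shows \<open>c\<close>: its first \<open>k\<close>
  letters act and the other \<open>j - k\<close> enter the bracket. The positions in front are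
  governed by \<open>d\<close>.\<close>

lemma word_fun_append_rev:
  fixes x y :: 'a and c d :: "bool list"
  defines "h \<equiv> letter x y (word_fun (d @ rev c))" and "l \<equiv> \<lambda>b. if b then x else y"
  assumes n: "length d + length c = n" and j: "length c = j"
  shows "k \<le> j \<Longrightarrow> descending h (Suc (Suc n)) (Suc (Suc n) - k + 1) = take k (map l c)"
    and "k \<le> j \<Longrightarrow> descending h (Suc (Suc n) - k) (Suc (Suc n) - j + 1) = drop k (map l c)"
    and "i \<in> {1..length d + 2} \<Longrightarrow> h i = letter x y (word_fun d) i"
proof -
  have nth: "descending h a b ! i = h (a - i)" if "i < a + 1 - b" for a b i
    using that by (simp add: descending_def rev_nth del: upt_Suc)
  have len: "length (descending h a b) = a + 1 - b" for a b
    by (simp add: descending_def del: upt_Suc)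
  have h: "h (Suc (Suc n) - i) = l (c ! i)" if "i < j" for i
  proof -
    have "Suc (Suc n) - i \<in> {1..length (d @ rev c) + 2}" using that n j by auto
    moreover have "(True # False # d @ rev c) ! (Suc (Suc n) - i - 1) = c ! i"
    proof -
      have "Suc (Suc n) - i - 1 = Suc (Suc (length d + (j - Suc i)))" using that n j by simp
      thus ?thesis using that j by (simp only: nth_Cons_Suc nth_append_length_plus) (simp add: rev_nth)
    qed
    ultimately show ?thesis by (simp add: h_def letter_def word_fun_def l_def del: append.simps)
  qed
  show "descending h (Suc (Suc n)) (Suc (Suc n) - k + 1) = take k (map l c)" if "k \<le> j"
    using that n j by (intro nth_equalityI) (simp_all add: len nth h diff_diff_left)
  show "descending h (Suc (Suc n) - k) (Suc (Suc n) - j + 1) = drop k (map l c)" if "k \<le> j"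
    using that n j by (intro nth_equalityI) (simp_all add: len nth h diff_diff_left)
  show "h i = letter x y (word_fun d) i" if "i \<in> {1..length d + 2}"
    using that by (auto simp: h_def letter_def word_fun_def nth_append nth_Cons split: nat.splits)
qed

lemma sum_fun_apply: "(\<Sum>i\<in>I. F i) x = (\<Sum>i\<in>I. F i x :: 'b::comm_monoid_add)"
  by (induction I rule: infinite_finite_induct) auto

text \<open>The summands agree for each \<open>j\<close>, but only after summing over words. The
  last two arguments of \<alpha> see just the first \<open>p - j\<close> letters; with these fixed,
  \<open>sum_acts_hom_act\<close> handles the sum over the last \<open>j\<close> letters.\<close>

lemma star_star_sum_eq:
  fixes L :: "('f::field, 'a::ab_group_add) restricted_lie"
  assumes lin: "\<And>x. Vector_Spaces.linear s s (act x)" and p: "CHAR('f) = Suc (Suc n)"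
  shows "star_star_sum L s act \<alpha> x y z = star_sum L (hom_scale s) (hom_act L act) (\<lambda>a b x. \<alpha> x a b) y z x"
proof -
  interpret Vector_Spaces.linear s s "act 0" by fact
  have vs: "vector_space s" by unfold_locales
  let ?l = "\<lambda>b. if b then y else z" and ?h = "\<lambda>w. letter y z w" and ?p = "Suc (Suc n)"
  let ?c = "\<lambda>v. inverse (of_nat (num_first ?p (word_fun v))) :: 'f"
  let ?A = "\<lambda>j w. brks L (?h w 1) (ascending (?h w) 2 (?p - j - 1))" and ?B = "\<lambda>j w. ?h w (?p - j)"
  define T where "T = (\<lambda>j v. \<Sum>k = 0..j. s (of_nat (j choose k)) (acts act (descending (?h (word_fun v)) ?p (?p - k + 1))
      (\<alpha> (brks L x (descending (?h (word_fun v)) (?p - k) (?p - j + 1))) (?A j (word_fun v)) (?B j (word_fun v)))))"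
  define U where "U = (\<lambda>j v. acts (hom_act L act) (descending (?h (word_fun v)) ?p (?p - j + 1))
      (\<lambda>x. \<alpha> x (?A j (word_fun v)) (?B j (word_fun v))))"
  have TU: "(\<Sum>v | length v = n. s (?c v) (T j v)) = (\<Sum>v | length v = n. s (?c v) (U j v x))" if j: "j \<le> n" for j
  proof -
    have "(\<Sum>c | length c = j. s (?c (d @ rev c)) (T j (d @ rev c))) = (\<Sum>c | length c = j. s (?c (d @ rev c)) (U j (d @ rev c) x))"
      if d: "length d = n - j" for d
    proof -
      \<comment> \<open>The weight of a word depends on its last block only through the number of
        \<open>True\<close> in it, so it can be absorbed into the counter argument of
        \<open>f\<close>.\<close>
      define f where "f = (\<lambda>m x. s (inverse (of_nat (Suc (count_list d True + m)))) (\<alpha> x (?A j (word_fun d)) (?B j (word_fun d))))"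
      have word: "?A j (word_fun (d @ rev c)) = ?A j (word_fun d)" "?B j (word_fun (d @ rev c)) = ?B j (word_fun d)"
        "?c (d @ rev c) = inverse (of_nat (Suc (count_list d True + count_list c True)))"
        "descending (?h (word_fun (d @ rev c))) ?p (?p - k + 1) = take k (map ?l c)"
        "descending (?h (word_fun (d @ rev c))) (?p - k) (?p - j + 1) = drop k (map ?l c)"
        if c: "length c = j" and k: "k \<le> j" for c k
      proof -
        have n: "length d + length c = n" using c d j by simp
        note h = word_fun_append_rev[OF n c, of _ y z]
        show "descending (?h (word_fun (d @ rev c))) ?p (?p - k + 1) = take k (map ?l c)"
          "descending (?h (word_fun (d @ rev c))) (?p - k) (?p - j + 1) = drop k (map ?l c)"
          using h(1,2)[OF k] .
        have "ascending (?h (word_fun (d @ rev c))) 2 (?p - j - 1) = ascending (?h (word_fun d)) 2 (?p - j - 1)"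
          unfolding ascending_def by (rule map_cong[OF refl], rule h(3)) (use j d in auto)
        moreover have "?h (word_fun (d @ rev c)) 1 = ?h (word_fun d) 1" by (rule h(3)) simp
        ultimately show "?A j (word_fun (d @ rev c)) = ?A j (word_fun d)" by simp
        show "?B j (word_fun (d @ rev c)) = ?B j (word_fun d)" by (rule h(3)) (use j d in auto)
        show "?c (d @ rev c) = inverse (of_nat (Suc (count_list d True + count_list c True)))"
          using num_first_word_fun[of "d @ rev c"] n by simp
      qed
      have "s (?c (d @ rev c)) (T j (d @ rev c)) = (\<Sum>k\<le>j. s (of_nat (j choose k))
         (acts act (take k (map ?l c)) (f (count_list c True) (brks L x (drop k (map ?l c))))))" if c: "length c = j" for c
        unfolding T_def vs1.scale_sum_right atMost_atLeast0
      proof (rule sum.cong[OF refl])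
        fix k assume "k \<in> {0..j}"
        hence "k \<le> j" by simp
        note word = word[OF c this]
        show "s (?c (d @ rev c)) (s (of_nat (j choose k)) (acts act (descending (?h (word_fun (d @ rev c))) ?p (?p - k + 1))
            (\<alpha> (brks L x (descending (?h (word_fun (d @ rev c))) (?p - k) (?p - j + 1)))
              (?A j (word_fun (d @ rev c))) (?B j (word_fun (d @ rev c)))))) =
          s (of_nat (j choose k)) (acts act (take k (map ?l c)) (f (count_list c True) (brks L x (drop k (map ?l c)))))"
          unfolding word f_def linear_scale[OF acts_linear[OF lin vs]] by (rule vs1.scale_left_commute)
      qed
      moreover have "s (?c (d @ rev c)) (U j (d @ rev c) x) = acts (hom_act L act) (map ?l c) (f (count_list c True)) x"
        if c: "length c = j" for c
      proof -
        have "f m = hom_scale s (inverse (of_nat (Suc (count_list d True + m)))) (\<lambda>x. \<alpha> x (?A j (word_fun d)) (?B j (word_fun d)))" for m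
          by (simp add: f_def hom_scale_def)
        thus ?thesis
          using word[OF c order_refl]
          by (simp only: U_def linear_scale[OF acts_linear[OF hom_act_linear[OF lin] vector_space_hom_scale[OF vs]]] take_all length_map c order_refl)
            (simp add: hom_scale_def)
      qed
      ultimately show ?thesis
        using sum_acts_hom_act[OF lin, where L = L and l = ?l and f = f and x = x and j = j]
        by (simp add: vs1.scale_sum_right) (rule sum.swap)
    qed
    thus ?thesis by (simp add: sum_lists_append_rev[OF j])
  qed
  have "star_star_sum L s act \<alpha> x y z = (\<Sum>v | length v = n. s (?c v) (\<Sum>j = 0..n. s ((- 1) ^ j) (T j v)))"
    by (simp add: star_star_sum_def Let_def p sum_symbol_words_lists T_def)
  also have "\<dots> = (\<Sum>j = 0..n. s ((- 1) ^ j) (\<Sum>v | length v = n. s (?c v) (T j v)))"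
    by (simp only: vs1.scale_sum_right vs1.scale_left_commute[of "(- 1) ^ _"]) (rule sum.swap)
  also have "\<dots> = (\<Sum>j = 0..n. s ((- 1) ^ j) (\<Sum>v | length v = n. s (?c v) (U j v x)))"
    by (simp add: TU)
  also have "\<dots> = (\<Sum>v | length v = n. s (?c v) (\<Sum>j = 0..n. s ((- 1) ^ j) (U j v x)))"
    by (simp only: vs1.scale_sum_right vs1.scale_left_commute[of "(- 1) ^ _"]) (rule sum.swap)
  also have "\<dots> = star_sum L (hom_scale s) (hom_act L act) (\<lambda>a b x. \<alpha> x a b) y z x"
    by (simp add: star_sum_def Let_def p sum_symbol_words_lists U_def sum_fun_apply hom_scale_def)
  finally show ?thesis .
qed

section \<open>Linearity and equivariance of the star sum\<close>

lemma star_sum_add: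
  assumes "vector_space s" and "\<And>x. Vector_Spaces.linear s s (act x)"
  shows "star_sum L s act (\<lambda>a b. \<psi> a b + \<psi>' a b) x y = star_sum L s act \<psi> x y + star_sum L s act \<psi>' x y"
proof -
  interpret vector_space s by fact
  note lin = acts_linear[OF assms(2,1)]
  show ?thesis by (simp add: star_sum_def Let_def linear_add[OF lin] scale_right_distrib sum.distrib)
qed

lemma star_sum_equivariant:
  assumes "Vector_Spaces.linear s s' T" and "\<And>x v. T (act x v) = act' x (T v)"
  shows "T (star_sum L s act \<psi> x y) = star_sum L s' act' (\<lambda>a b. T (\<psi> a b)) x y"
proof -
  have "T (acts act bs v) = acts act' bs (T v)" for bs v
    by (induction bs) (simp_all add: acts_def assms(2))
  thus ?thesis
    by (simp add: star_sum_def Let_def linear_sum[OF assms(1)] linear_scale[OF assms(1)])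
qed

lemma star_sum_scale:
  assumes "vector_space s" and "\<And>x. Vector_Spaces.linear s s (act x)"
  shows "star_sum L s act (\<lambda>a b. s c (\<psi> a b)) x y = s c (star_sum L s act \<psi> x y)"
proof -
  interpret vector_space s by fact
  show ?thesis
    by (rule star_sum_equivariant[symmetric])
      (auto intro!: linearI assms(1) simp: scale_right_distrib scale_left_commute linear_scale[OF assms(2)])
qed

lemma star_sum_diff:
  assumes "vector_space s" and "\<And>x. Vector_Spaces.linear s s (act x)"
  shows "star_sum L s act (\<lambda>a b. \<psi> a b - \<psi>' a b) x y = star_sum L s act \<psi> x y - star_sum L s act \<psi>' x y"
  using star_sum_add[OF assms, where \<psi> = "\<lambda>a b. \<psi> a b - \<psi>' a b" and \<psi>' = \<psi>'] by simp

section \<open>Restricted modules\<close>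

lemma linear_fun_diff:
  assumes "Vector_Spaces.linear s1 s2 f" and "Vector_Spaces.linear s1 s2 g"
  shows "Vector_Spaces.linear s1 s2 (\<lambda>x. f x - g x)"
proof -
  interpret f: Vector_Spaces.linear s1 s2 f by fact
  interpret g: Vector_Spaces.linear s1 s2 g by fact
  show ?thesis
    by (intro linearI f.vs1.vector_space_axioms f.vs2.vector_space_axioms)
      (simp_all add: f.add g.add f.scale g.scale f.vs2.scale_right_diff_distrib)
qed

locale restricted_rep =
  fixes L :: "('f::field, 'a::ab_group_add) restricted_lie"
    and s :: "'f \<Rightarrow> 'v::ab_group_add \<Rightarrow> 'v"
    and act :: "'a \<Rightarrow> 'v \<Rightarrow> 'v"
  assumes char: "CHAR('f) \<ge> 3"
    and L: "restricted_lie_algebra L"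
    and module: "restricted_module L s act"
begin

lemma vs: "vector_space s"
  and act_linear: "Vector_Spaces.linear s s (act x)"
  and act_linear_left: "Vector_Spaces.linear (scal L) s (\<lambda>x. act x v)"
  and act_brk: "act (brk L x y) v = act x (act y v) - act y (act x v)"
  and act_pmap: "act (pmap L x) v = (act x ^^ CHAR('f)) v"
  using module unfolding restricted_module_def by blast+

lemma lie: "lie_algebra L"
  using L by (simp add: restricted_lie_algebra_def)

lemma brk_linear: "Vector_Spaces.linear (scal L) (scal L) (\<lambda>y. brk L x y)"
  and brk_linear_left: "Vector_Spaces.linear (scal L) (scal L) (\<lambda>x. brk L x y)"
  and brk_same: "brk L x x = 0"
  and jacobi: "brk L x (brk L y z) + brk L y (brk L z x) + brk L z (brk L x y) = 0"
  and brk_pmap: "brk L x (pmap L y) = ((\<lambda>u. brk L u y) ^^ CHAR('f)) x"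
  using L unfolding restricted_lie_algebra_def lie_algebra_def by blast+

sublocale lie_rep L s act UNIV
proof (rule lie_rep.intro)
  interpret vector_space s by (fact vs)
  show "module.subspace s UNIV" by simp
qed (use char L vs act_linear act_linear_left act_brk in auto)

lemmas act_simps = linear_add[OF act_linear] linear_diff[OF act_linear] linear_neg[OF act_linear]
  linear_zero[OF act_linear] linear_scale[OF act_linear] linear_add[OF act_linear_left]
  linear_scale[OF act_linear_left] linear_zero[OF act_linear_left]

lemma brk_skew: "brk L y x = - brk L x y"
  using brk_same[of "x + y"] unfolding linear_add[OF brk_linear] linear_add[OF brk_linear_left]
  by (simp add: brk_same eq_neg_iff_add_eq_0)

lemma brk_brk: "brk L x (brk L y z) = brk L (brk L x y) z + brk L y (brk L x z)"
  using jacobi[of x y z] brk_skew[of z "brk L x y"] brk_skew[of z x]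
  by (simp add: linear_neg[OF brk_linear] algebra_simps eq_neg_iff_add_eq_0)

abbreviation hom_space :: "('a \<Rightarrow> 'v) set" where
  "hom_space \<equiv> {f. Vector_Spaces.linear (scal L) s f}"

sublocale hom: lie_rep L "hom_scale s" "hom_act L act" hom_space
proof (rule lie_rep.intro)
  interpret vector_space s by (fact vs)
  show "CHAR('f) \<ge> 3" "restricted_lie_algebra L" by (fact char L)+
  show vs': "vector_space (hom_scale s)" by (rule vector_space_hom_scale[OF vs])
  then interpret hom: vector_space "hom_scale s" .
  show "Vector_Spaces.linear (hom_scale s) (hom_scale s) (hom_act L act x)" for x
    by (rule hom_act_linear[OF act_linear])
  show "module.subspace (hom_scale s) hom_space"
    unfolding hom.subspace_def
    by (auto intro!: linearI vs vector_space_L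
        simp: hom_scale_def linear_add linear_scale scale_right_distrib scale_left_commute)
  fix f assume f: "f \<in> hom_space"
  hence lin: "Vector_Spaces.linear (scal L) s f" by simp
  show "hom_act L act x f \<in> hom_space" for x
    by (auto intro!: linearI vs vector_space_L simp: hom_act_def linear_add[OF lin] linear_scale[OF lin]
        linear_add[OF brk_linear_left] linear_scale[OF brk_linear_left] act_simps scale_right_distrib)
  show "Vector_Spaces.linear (scal L) (hom_scale s) (\<lambda>x. hom_act L act x f)"
    by (auto intro!: linearI vs' vector_space_L simp: hom_act_def hom_scale_def fun_eq_iff linear_add[OF lin] linear_scale[OF lin]
        linear_add[OF brk_linear] linear_scale[OF brk_linear] act_simps scale_right_distrib)
  show "hom_act L act (brk L x y) f = hom_act L act x (hom_act L act y f) - hom_act L act y (hom_act L act x f)" for x y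
  proof
    fix z
    have "brk L z (brk L x y) = brk L (brk L z x) y - brk L (brk L z y) x"
      using brk_brk[of z x y] brk_skew[of x "brk L z y"] by simp
    thus "hom_act L act (brk L x y) f z = (hom_act L act x (hom_act L act y f) - hom_act L act y (hom_act L act x f)) z"
      by (simp add: hom_act_def act_brk act_simps linear_diff[OF lin])
  qed
qed

text \<open>Hom(L, V) is again restricted: in the binomial expansion of the p-th power the middle
  coefficients vanish in characteristic p, and the two end terms are the p-map acting on V and on
  L.\<close>

lemma hom_act_pmap:
  assumes f: "f \<in> hom_space"
  shows "(hom_act L act y ^^ CHAR('f)) f = hom_act L act (pmap L y) f"
proof
  interpret vector_space s by (fact vs)
  obtain n where p: "CHAR('f) = Suc n" using char_eq by blast
  fix x
  let ?t = "\<lambda>k. s (of_nat (CHAR('f) choose k)) ((act y ^^ k) (f (((\<lambda>u. brk L u y) ^^ (CHAR('f) - k)) x)))"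
  have "?t (Suc k) = 0" if "k < n" for k
  proof -
    have "CHAR('f) dvd (CHAR('f) choose Suc k)"
      using prime_char that p by (intro dvd_choose_prime) auto
    hence "(of_nat (CHAR('f) choose Suc k) :: 'f) = 0" by (simp only: of_nat_eq_0_iff_char_dvd)
    thus ?thesis by simp
  qed
  hence "(\<Sum>k<n. ?t (Suc k)) = 0" by (intro sum.neutral) simp
  hence "(\<Sum>k\<le>n. ?t (Suc k)) = ?t (Suc n)" by (simp add: lessThan_Suc_atMost[symmetric])
  moreover have "(hom_act L act y ^^ CHAR('f)) f x = (\<Sum>k\<le>Suc n. ?t k)"
    unfolding hom_act_power[OF act_linear] by (simp only: p)
  ultimately have "(hom_act L act y ^^ CHAR('f)) f x = ?t 0 + ?t (Suc n)"
    by (simp only: sum.atMost_Suc_shift)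
  also have "\<dots> = hom_act L act (pmap L y) f x"
    by (simp add: hom_act_def act_pmap brk_pmap p[symmetric])
  finally show "(hom_act L act y ^^ CHAR('f)) f x = hom_act L act (pmap L y) f x" .
qed

lemma ind2_eq: "ind2 L s act \<alpha> \<beta> x y = ind1 L (hom_act L act) (\<lambda>y x. \<alpha> x y) y x - act x (\<beta> y)"
proof -
  have sum: "(\<Sum>(i, j)\<in>{(i, j). i + j = m}. F i j) = (\<Sum>i\<le>m. F i (m - i))" for m and F :: "nat \<Rightarrow> nat \<Rightarrow> 'v"
    by (rule sum.reindex_bij_witness[of _ "\<lambda>i. (i, m - i)" fst]) auto
  have "(\<Sum>(i, j)\<in>{(i, j). i + j = CHAR('f) - 1}. s ((- 1) ^ i) ((act y ^^ i) (\<alpha> (((\<lambda>u. brk L u y) ^^ j) x) y)))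
    = (\<Sum>i\<le>CHAR('f) - 1. s ((- 1) ^ i) ((act y ^^ i) (\<alpha> (((\<lambda>u. brk L u y) ^^ (CHAR('f) - 1 - i)) x) y)))"
    by (rule sum)
  also have "\<dots> = (hom_act L act y ^^ (CHAR('f) - 1)) (\<lambda>x. \<alpha> x y) x"
    unfolding hom_act_power[OF act_linear]
    by (rule sum.cong) (simp_all add: of_nat_prime_choose_minus_one[OF prime_char of_nat_CHAR, unfolded One_nat_def])
  finally show ?thesis by (simp add: ind2_def ind1_def)
qed

text \<open>Equivariance of \<iota>: the bracket term of \<open>hom_act\<close> turns y.(x.v) into
  x.(y.v).\<close>

lemma hom_act_const_act: "hom_act L act y (\<lambda>x. act x v) = (\<lambda>x. act x (act y v))"
  by (simp add: hom_act_def fun_eq_iff act_brk)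

lemma hom_act_const_act_power: "(hom_act L act y ^^ n) (\<lambda>x. act x v) = (\<lambda>x. act x ((act y ^^ n) v))"
  by (induction n) (simp_all add: hom_act_const_act)

lemma ind2_dCE1:
  assumes \<psi>: "\<psi> \<in> CE1 L s"
  shows "ind2 L s act (dCE1 L act \<psi>) (ind1 L act \<psi>) x y = 0"
proof -
  have \<psi>: "\<psi> \<in> hom_space" using \<psi> by (simp add: CE1_def)
  obtain n where p: "CHAR('f) = Suc n" using char_eq by blast
  have eq: "(\<lambda>x. dCE1 L act \<psi> x y) = (\<lambda>x. act x (\<psi> y)) - hom_act L act y \<psi>" for y
    by (simp add: dCE1_def hom_act_def fun_eq_iff)
  \<comment> \<open>In Hom(L, V), \<open>y\<close> acting p - 1 times on y.\<psi> is the p-map of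
    \<open>y\<close> acting on \<psi>. This cancels the same term in the coboundary at the p-map of
    \<open>y\<close>; the \<iota>-parts cancel against x applied to
    \<open>ind1 L act \<psi> y\<close>.\<close>
  have "(hom_act L act y ^^ (CHAR('f) - 1)) (hom_act L act y \<psi>) = hom_act L act (pmap L y) \<psi>"
    using hom_act_pmap[OF \<psi>, of y] by (simp add: p funpow_swap1)
  thus ?thesis
    by (simp add: ind2_eq ind1_def eq linear_diff[OF hom.act_power_linear] hom_act_const_act_power act_simps)
qed

section \<open>Chevalley-Eilenberg coboundaries\<close>

lemma CE2_linear:
  assumes "\<psi> \<in> CE2 L s"
  shows "Vector_Spaces.linear (scal L) s (\<lambda>y. \<psi> x y)" "Vector_Spaces.linear (scal L) s (\<lambda>x. \<psi> x y)" "\<psi> x x = 0"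
  using assms by (auto simp: CE2_def)

lemma CE2_skew:
  assumes "\<psi> \<in> CE2 L s"
  shows "\<psi> y x = - \<psi> x y"
  using CE2_linear(3)[OF assms, of "x + y"]
  unfolding linear_add[OF CE2_linear(1)[OF assms]] linear_add[OF CE2_linear(2)[OF assms]]
  by (simp add: CE2_linear(3)[OF assms] eq_neg_iff_add_eq_0)

lemma dCE1_CE2:
  assumes "\<psi> \<in> CE1 L s"
  shows "dCE1 L act \<psi> \<in> CE2 L s"
proof -
  interpret vector_space s by (fact vs)
  have lin: "Vector_Spaces.linear (scal L) s \<psi>" using assms by (simp add: CE1_def)
  show ?thesis
    by (auto simp: CE2_def dCE1_def brk_same linear_zero[OF lin] linear_add[OF lin] linear_scale[OF lin]
        linear_add[OF brk_linear] linear_scale[OF brk_linear] linear_add[OF brk_linear_left] linear_scale[OF brk_linear_left]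
        act_simps scale_right_distrib scale_right_diff_distrib intro!: linearI vector_space_L vs)
qed

lemma dCE2_CE3:
  assumes "\<psi> \<in> CE2 L s"
  shows "dCE2 L act \<psi> \<in> CE3 L s"
proof -
  interpret vector_space s by (fact vs)
  note lin = CE2_linear[OF assms]
  note simps = linear_zero[OF lin(1)] linear_zero[OF lin(2)] linear_add[OF lin(1)] linear_add[OF lin(2)] linear_scale[OF lin(1)] linear_scale[OF lin(2)]
        linear_add[OF brk_linear] linear_scale[OF brk_linear] linear_add[OF brk_linear_left] linear_scale[OF brk_linear_left]
        act_simps scale_right_distrib scale_right_diff_distrib lin(3) brk_same
  have alt: "dCE2 L act \<psi> x x y = 0" "dCE2 L act \<psi> x y x = 0" "dCE2 L act \<psi> y x x = 0" for x y
    using CE2_skew[OF assms, of x y] brk_skew[of x y]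
    by (simp_all add: dCE2_def simps linear_neg[OF lin(2)])
  have "Vector_Spaces.linear (scal L) s (\<lambda>x. dCE2 L act \<psi> x y z)" "Vector_Spaces.linear (scal L) s (\<lambda>y. dCE2 L act \<psi> x y z)"
    "Vector_Spaces.linear (scal L) s (\<lambda>z. dCE2 L act \<psi> x y z)" for x y z
    by (intro linearI vector_space_L vs; simp add: dCE2_def simps)+
  thus ?thesis by (simp add: CE3_def alt)
qed

lemma dCE2_dCE1:
  assumes "\<psi> \<in> CE1 L s"
  shows "dCE2 L act (dCE1 L act \<psi>) x y z = 0"
proof -
  have lin: "Vector_Spaces.linear (scal L) s \<psi>" using assms by (simp add: CE1_def)
  \<comment> \<open>The Jacobi identity cancels the three double brackets inside \<psi>; the terms
    with two actions cancel by \<open>act_brk\<close>.\<close>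
  have "brk L (brk L x z) y = brk L (brk L x y) z + brk L x (brk L z y)"
    using brk_brk[of x z y] brk_skew[of z "brk L x y"] brk_skew[of z y]
    by (simp add: algebra_simps linear_neg[OF brk_linear])
  hence "\<psi> (brk L (brk L x z) y) = \<psi> (brk L (brk L x y) z) - \<psi> (brk L x (brk L y z))"
    using brk_skew[of z y] by (simp add: linear_diff[OF lin] linear_neg[OF lin] linear_neg[OF brk_linear])
  thus ?thesis
    using brk_skew[of "brk L y z" x]
    by (simp add: dCE2_def dCE1_def act_simps act_brk linear_neg[OF lin] algebra_simps)
qed

text \<open>Of the six terms of \<open>dCE2\<close>, one has \<open>x\<close> acting; the other five
  are, up to sign, the coboundary in Hom(L, V), once \<alpha> is made to take \<open>x\<close> first
  by skew symmetry.\<close>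

lemma dCE1_hom:
  assumes \<alpha>: "\<alpha> \<in> CE2 L s"
  shows "dCE1 L (hom_act L act) (\<lambda>y x. \<alpha> x y) a b x = act x (\<alpha> a b) - dCE2 L act \<alpha> x a b"
  using CE2_skew[OF \<alpha>, of x "brk L a b"] by (simp add: dCE1_def dCE2_def hom_act_def)

lemma ind2_star_star:
  assumes \<alpha>: "\<alpha> \<in> CE2 L s" and \<beta>: "star_property L s act \<alpha> \<beta>"
  shows "star_star_property L s act (dCE2 L act \<alpha>) (ind2 L s act \<alpha> \<beta>)"
proof -
  interpret vector_space s by (fact vs)
  let ?\<alpha> = "\<lambda>y x. \<alpha> x y"
  obtain n where p: "CHAR('f) = Suc (Suc n)" using char_eq by blast
  have lin: "Vector_Spaces.linear (scal L) (hom_scale s) ?\<alpha>"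
    using CE2_linear[OF \<alpha>]
    by (intro linearI vector_space_L vector_space_hom_scale vs)
      (auto simp: fun_eq_iff hom_scale_def linear_add[OF CE2_linear(1)[OF \<alpha>]] linear_scale[OF CE2_linear(1)[OF \<alpha>]])
  have hom: "?\<alpha> y \<in> hom_space" for y using CE2_linear(2)[OF \<alpha>] by simp
  have linear: "Vector_Spaces.linear (scal L) s (\<lambda>x. ind2 L s act \<alpha> \<beta> x y)" for y
  proof -
    have "Vector_Spaces.linear (scal L) s (ind1 L (hom_act L act) ?\<alpha> y)"
      using hom.ind1_V[OF lin hom] by simp
    thus ?thesis unfolding ind2_eq
      using act_linear_left[OF UNIV_I] by (rule linear_fun_diff)
  qed
  have scale: "ind2 L s act \<alpha> \<beta> x (scal L c y) = s (c ^ CHAR('f)) (ind2 L s act \<alpha> \<beta> x y)" for c x y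
    using \<beta> by (simp add: ind2_eq hom.ind1_scale[OF lin hom] star_property_def act_simps scale_right_diff_distrib)
      (simp add: hom_scale_def)
  have add: "ind2 L s act \<alpha> \<beta> x (y + z) = ind2 L s act \<alpha> \<beta> x y + ind2 L s act \<alpha> \<beta> x z
     - star_star_sum L s act (dCE2 L act \<alpha>) x y z" for x y z
  proof -
    let ?T = "\<lambda>v x. act x v"
    have T: "Vector_Spaces.linear s (hom_scale s) ?T"
      by (intro linearI vs vector_space_hom_scale) (simp_all add: fun_eq_iff hom_scale_def act_simps)
    have equivariant: "star_sum L (hom_scale s) (hom_act L act) (\<lambda>a b x. act x (\<alpha> a b)) y z = (\<lambda>x. act x (star_sum L s act \<alpha> y z))"
      by (rule star_sum_equivariant[where T = ?T, OF T, symmetric]) (simp add: hom_act_const_act)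
    \<comment> \<open>By equivariance the \<iota>-part contributes x applied to
      \<open>star_sum\<close> of \<alpha>, which is the additivity defect of x.\<beta>(y) and
      cancels it. The other part leaves the double star sum with a minus sign.\<close>
    have "dCE1 L (hom_act L act) ?\<alpha> = (\<lambda>a b. ?T (\<alpha> a b) - (\<lambda>x. dCE2 L act \<alpha> x a b))"
      by (simp add: fun_eq_iff dCE1_hom[OF \<alpha>])
    hence "star_sum L (hom_scale s) (hom_act L act) (dCE1 L (hom_act L act) ?\<alpha>) y z x =
      act x (star_sum L s act \<alpha> y z) - star_star_sum L s act (dCE2 L act \<alpha>) x y z"
      by (simp add: star_sum_diff[OF hom.vs hom.act_linear] star_star_sum_eq[OF act_linear p]
          equivariant)
    thus ?thesis
      using \<beta> by (simp add: ind2_eq hom.ind1_add[OF lin hom] star_property_def act_simps)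
  qed
  show ?thesis by (simp add: star_star_property_def linear scale add)
qed

section \<open>Linear structure on restricted cochains\<close>

lemma cochain_add:
  "dCE1 L act (f + g) = dCE1 L act f + dCE1 L act g"
  "ind1 L act (f + g) = ind1 L act f + ind1 L act g"
  "dCE2 L act (\<alpha> + \<alpha>') = dCE2 L act \<alpha> + dCE2 L act \<alpha>'"
  "ind2 L s act (\<alpha> + \<alpha>') (\<beta> + \<beta>') = ind2 L s act \<alpha> \<beta> + ind2 L s act \<alpha>' \<beta>'"
proof -
  interpret vector_space s by (fact vs)
  show "dCE1 L act (f + g) = dCE1 L act f + dCE1 L act g" "ind1 L act (f + g) = ind1 L act f + ind1 L act g"
    "dCE2 L act (\<alpha> + \<alpha>') = dCE2 L act \<alpha> + dCE2 L act \<alpha>'"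
    by (simp_all add: fun_eq_iff dCE1_def ind1_def dCE2_def act_simps linear_add[OF act_power_linear])
  show "ind2 L s act (\<alpha> + \<alpha>') (\<beta> + \<beta>') = ind2 L s act \<alpha> \<beta> + ind2 L s act \<alpha>' \<beta>'"
    by (simp add: fun_eq_iff ind2_def act_simps linear_add[OF act_power_linear] scale_right_distrib sum.distrib case_prod_beta)
qed

lemma cochain_scale:
  "dCE1 L act (\<lambda>x. s c (f x)) = (\<lambda>x y. s c (dCE1 L act f x y))"
  "ind1 L act (\<lambda>x. s c (f x)) = (\<lambda>x. s c (ind1 L act f x))"
  "dCE2 L act (\<lambda>x y. s c (\<alpha> x y)) = (\<lambda>x y z. s c (dCE2 L act \<alpha> x y z))"
  "ind2 L s act (\<lambda>x y. s c (\<alpha> x y)) (\<lambda>x. s c (\<beta> x)) = (\<lambda>x y. s c (ind2 L s act \<alpha> \<beta> x y))"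
proof -
  interpret vector_space s by (fact vs)
  show "dCE1 L act (\<lambda>x. s c (f x)) = (\<lambda>x y. s c (dCE1 L act f x y))"
    "ind1 L act (\<lambda>x. s c (f x)) = (\<lambda>x. s c (ind1 L act f x))"
    "dCE2 L act (\<lambda>x y. s c (\<alpha> x y)) = (\<lambda>x y z. s c (dCE2 L act \<alpha> x y z))"
    by (simp_all add: fun_eq_iff dCE1_def ind1_def dCE2_def act_simps linear_scale[OF act_power_linear]
        scale_right_distrib scale_right_diff_distrib)
  show "ind2 L s act (\<lambda>x y. s c (\<alpha> x y)) (\<lambda>x. s c (\<beta> x)) = (\<lambda>x y. s c (ind2 L s act \<alpha> \<beta> x y))"
    by (simp add: fun_eq_iff ind2_def act_simps linear_scale[OF act_power_linear] scale_right_distrib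
        scale_right_diff_distrib scale_sum_right mult.commute case_prod_beta)
qed

lemma CE1_closed: "0 \<in> CE1 L s" "f \<in> CE1 L s \<Longrightarrow> g \<in> CE1 L s \<Longrightarrow> f + g \<in> CE1 L s"
  "f \<in> CE1 L s \<Longrightarrow> (\<lambda>x. s c (f x)) \<in> CE1 L s"
  using hom.V_closed(3) hom.V_closed(1)[of f g] hom.V_closed(2)[of f c] by (simp_all add: CE1_def hom_scale_def)

text \<open>The star property is a linear condition on the pair, because \<open>star_sum\<close> is
  linear in the bilinear map.\<close>

lemma Cst2_closed: "0 \<in> Cst2 L s act"
  "u \<in> Cst2 L s act \<Longrightarrow> v \<in> Cst2 L s act \<Longrightarrow> u + v \<in> Cst2 L s act"
  "(\<psi>, \<omega>) \<in> Cst2 L s act \<Longrightarrow> (\<lambda>x y. s c (\<psi> x y), \<lambda>x. s c (\<omega> x)) \<in> Cst2 L s act"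
proof -
  interpret vector_space s by (fact vs)
  have CE2: "\<psi> \<in> CE2 L s \<longleftrightarrow> (\<forall>x. \<psi> x \<in> CE1 L s) \<and> (\<forall>y. (\<lambda>x. \<psi> x y) \<in> CE1 L s) \<and> (\<forall>x. \<psi> x x = 0)" for \<psi>
    by (simp add: CE2_def CE1_def)
  have add: "\<psi> + \<psi>' \<in> CE2 L s" if "\<psi> \<in> CE2 L s" "\<psi>' \<in> CE2 L s" for \<psi> \<psi>'
    using that CE1_closed(2)[unfolded plus_fun_def] by (simp add: CE2 CE1_closed(2))
  have scale: "(\<lambda>x y. s c (\<psi> x y)) \<in> CE2 L s" if "\<psi> \<in> CE2 L s" for \<psi> c
    using that by (simp add: CE2 CE1_closed(3))
  show "0 \<in> Cst2 L s act"
    \<comment> \<open>Scaling the zero map by \<open>c = 0\<close> shows that its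
      \<open>star_sum\<close> vanishes.\<close>
    using CE1_closed(1) star_sum_scale[OF vs act_linear, where c = 0 and \<psi> = "\<lambda>x y. 0" and L = L]
    by (simp add: Cst2_def zero_prod_def CE2 star_property_def zero_fun_def)
  show "u + v \<in> Cst2 L s act" if "u \<in> Cst2 L s act" "v \<in> Cst2 L s act"
  proof -
    obtain \<psi> \<omega> \<psi>' \<omega>' where uv: "u = (\<psi>, \<omega>)" "v = (\<psi>', \<omega>')" by (cases u; cases v)
    have "star_sum L s act (\<psi> + \<psi>') x y = star_sum L s act \<psi> x y + star_sum L s act \<psi>' x y" for x y
      using star_sum_add[OF vs act_linear, where \<psi> = \<psi> and \<psi>' = \<psi>'] by (simp add: plus_fun_def)
    with that show ?thesis
      by (simp add: uv Cst2_def star_property_def add scale_right_distrib add_ac)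
  qed
  show "(\<psi>, \<omega>) \<in> Cst2 L s act \<Longrightarrow> (\<lambda>x y. s c (\<psi> x y), \<lambda>x. s c (\<omega> x)) \<in> Cst2 L s act"
    by (simp add: Cst2_def star_property_def scale star_sum_scale[OF vs act_linear] scale_right_distrib scale_left_commute mult.commute)
qed

end

section \<open>Cosets of a subspace\<close>

lemma quotient_well_definedI:
  assumes "vector_space s" and Z: "module.subspace s Z" and B: "module.subspace s B" and BZ: "B \<subseteq> Z"
  shows "quotient_well_defined s Z B"
proof -
  interpret vector_space s by fact
  define R where "R = quotient_relation Z B"
  have R: "(u, v) \<in> R \<longleftrightarrow> u \<in> Z \<and> v \<in> Z \<and> u - v \<in> B" for u v
    by (simp add: R_def quotient_relation_def)
  have equiv: "equiv Z R"
  proof (rule equivI)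
    show "R \<subseteq> Z \<times> Z" by (auto simp: R)
    show "refl_on Z R" using subspace_0[OF B] by (auto simp: refl_on_def R)
    show "sym R" using subspace_neg[OF B] by (auto simp: sym_def R) (metis minus_diff_eq)
    show "trans R"
    proof (rule transI)
      fix x y z assume "(x, y) \<in> R" "(y, z) \<in> R"
      thus "(x, z) \<in> R" using subspace_add[OF B, of "x - y" "y - z"] by (simp add: R)
    qed
  qed
  \<comment> \<open>A coset is determined by any one of its elements; this gives uniqueness in both
    operations below.\<close>
  have class_eq: "\<zeta> = R `` {u}" if "\<zeta> \<in> Z // R" "u \<in> \<zeta>" for \<zeta> u
    using that equiv by (metis Image_singleton_iff equiv_class_eq quotientE)
  have add: "\<exists>!\<zeta> \<in> Z // R. \<forall>u \<in> \<xi>. \<forall>v \<in> \<eta>. u + v \<in> \<zeta>" if \<xi>: "\<xi> \<in> Z // R" and \<eta>: "\<eta> \<in> Z // R" for \<xi> \<eta>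
  proof -
    obtain a where a: "\<xi> = R `` {a}" "a \<in> Z" using \<xi> by (rule quotientE)
    obtain b where b: "\<eta> = R `` {b}" "b \<in> Z" using \<eta> by (rule quotientE)
    have mem: "a \<in> \<xi>" "b \<in> \<eta>" using a b equiv_class_self[OF equiv] by auto
    show ?thesis
    proof (rule ex1I[of _ "R `` {a + b}"], intro conjI ballI)
      show "R `` {a + b} \<in> Z // R" using subspace_add[OF Z] a b by (auto intro: quotientI)
      show "u + v \<in> R `` {a + b}" if "u \<in> \<xi>" "v \<in> \<eta>" for u v
        using that a b subspace_add[OF Z] subspace_add[OF B, of "a - u" "b - v"] by (auto simp: R algebra_simps)
      show "\<zeta> = R `` {a + b}" if "\<zeta> \<in> Z // R \<and> (\<forall>u\<in>\<xi>. \<forall>v\<in>\<eta>. u + v \<in> \<zeta>)" for \<zeta>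
        using that class_eq mem by blast
    qed
  qed
  have scale: "\<exists>!\<zeta> \<in> Z // R. \<forall>u \<in> \<xi>. s c u \<in> \<zeta>" if \<xi>: "\<xi> \<in> Z // R" for \<xi> c
  proof -
    obtain a where a: "\<xi> = R `` {a}" "a \<in> Z" using \<xi> by (rule quotientE)
    have mem: "a \<in> \<xi>" using a equiv_class_self[OF equiv] by auto
    show ?thesis
    proof (rule ex1I[of _ "R `` {s c a}"], intro conjI ballI)
      show "R `` {s c a} \<in> Z // R" using subspace_scale[OF Z] a by (auto intro: quotientI)
      show "s c u \<in> R `` {s c a}" if "u \<in> \<xi>" for u
        using that a subspace_scale[OF Z] subspace_scale[OF B, of "a - u" c] by (auto simp: R scale_right_diff_distrib)
      show "\<zeta> = R `` {s c a}" if "\<zeta> \<in> Z // R \<and> (\<forall>u\<in>\<xi>. s c u \<in> \<zeta>)" for \<zeta>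
        using that class_eq mem by blast
    qed
  qed
  show ?thesis
    using assms equiv add scale by (simp add: quotient_well_defined_def quotient_space_def R_def)
qed

section \<open>The deformation complex\<close>

text \<open>Scalar multiplication on the target of \<open>def_d2\<close>, with which linearity of
  that map, and hence its kernel, can be treated.\<close>

definition def_scale3 ::
  "('f, 'a) restricted_lie \<Rightarrow> ('f, 'b) restricted_lie \<Rightarrow> 'f \<Rightarrow> ('a, 'b) def_cochain3 \<Rightarrow> ('a, 'b) def_cochain3"
where
  "def_scale3 L M c = (\<lambda>((\<alpha>, \<beta>), (\<alpha>', \<beta>'), (\<psi>, \<omega>)).
     ((\<lambda>x y z. scal L c (\<alpha> x y z), \<lambda>x y. scal L c (\<beta> x y)),
      (\<lambda>x y z. scal M c (\<alpha>' x y z), \<lambda>x y. scal M c (\<beta>' x y)),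
      (\<lambda>x y. scal M c (\<psi> x y), \<lambda>x. scal M c (\<omega> x))))"

lemma vector_space_def_scale:
  assumes "vector_space (scal L)" and "vector_space (scal M)"
  shows "vector_space (def_scale1 L M)" "vector_space (def_scale2 L M)" "vector_space (def_scale3 L M)"
proof -
  interpret L: vector_space "scal L" by fact
  interpret M: vector_space "scal M" by fact
  show "vector_space (def_scale1 L M)"
    by unfold_locales
      (auto simp: def_scale1_def fun_eq_iff L.scale_right_distrib L.scale_left_distrib M.scale_right_distrib M.scale_left_distrib)
  show "vector_space (def_scale2 L M)"
    by unfold_locales
      (auto simp: def_scale2_def fun_eq_iff L.scale_right_distrib L.scale_left_distrib M.scale_right_distrib M.scale_left_distrib)
  show "vector_space (def_scale3 L M)"
    by unfold_locales
      (auto simp: def_scale3_def fun_eq_iff L.scale_right_distrib L.scale_left_distrib M.scale_right_distrib M.scale_left_distrib)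
qed

locale def_complex =
  fixes L :: "('f::field, 'a::ab_group_add) restricted_lie"
    and M :: "('f, 'b::ab_group_add) restricted_lie"
    and \<phi> :: "'a \<Rightarrow> 'b"
  assumes char: "CHAR('f) \<ge> 3"
    and L: "restricted_lie_algebra L"
    and M: "restricted_lie_algebra M"
    and morphism: "restricted_morphism L M \<phi>"
begin

sublocale L: restricted_rep L "scal L" "brk L"
  by (rule restricted_rep.intro[OF char L restricted_module_adjoint[OF L]])

sublocale M: restricted_rep M "scal M" "brk M"
  by (rule restricted_rep.intro[OF char M restricted_module_adjoint[OF M]])

sublocale LM: restricted_rep L "scal M" "pullback_act M \<phi>"
  by (rule restricted_rep.intro[OF char L restricted_module_pullback[OF M morphism]])

lemma \<phi>_linear: "Vector_Spaces.linear (scal L) (scal M) \<phi>"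
  and \<phi>_brk: "\<phi> (brk L x y) = brk M (\<phi> x) (\<phi> y)"
  and \<phi>_pmap: "\<phi> (pmap L x) = pmap M (\<phi> x)"
  using morphism unfolding restricted_morphism_def by blast+

lemmas \<phi>_simps = linear_add[OF \<phi>_linear] linear_diff[OF \<phi>_linear] linear_neg[OF \<phi>_linear] linear_scale[OF \<phi>_linear]
  \<phi>_brk \<phi>_pmap

lemma \<phi>_brk_power: "\<phi> ((brk L x ^^ n) y) = (brk M (\<phi> x) ^^ n) (\<phi> y)"
  by (induction n) (simp_all add: \<phi>_brk)

lemma pullback_act_eq: "pullback_act M \<phi> x = brk M (\<phi> x)"
  by (simp add: pullback_act_def fun_eq_iff)

text \<open>The formulas are linear in all tuples of maps, cochains or not, although
  \<open>ind1\<close> is not linear in its vector argument. Kernels can thus be taken in the ambient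
  space and then intersected with the cochains.\<close>

lemma def_d1_linear: "Vector_Spaces.linear (def_scale1 L M) (def_scale2 L M) (def_d1 L M \<phi>)"
proof -
  interpret M': vector_space "scal M" by (fact M.vs)
  show ?thesis
  proof (intro linearI vector_space_def_scale L.vs M.vs)
    show "def_d1 L M \<phi> (u + v) = def_d1 L M \<phi> u + def_d1 L M \<phi> v" for u v
      by (cases u; cases v) (simp add: def_d1_def L.cochain_add M.cochain_add, simp add: fun_eq_iff \<phi>_simps dCE0_def LM.act_simps)
    show "def_d1 L M \<phi> (def_scale1 L M c u) = def_scale2 L M c (def_d1 L M \<phi> u)" for c u
      by (cases u) (simp add: def_d1_def def_scale1_def def_scale2_def L.cochain_scale M.cochain_scale \<phi>_simps dCE0_def LM.act_simps M'.scale_right_diff_distrib)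
  qed
qed

lemma def_d2_linear: "Vector_Spaces.linear (def_scale2 L M) (def_scale3 L M) (def_d2 L M \<phi>)"
proof -
  interpret M': vector_space "scal M" by (fact M.vs)
  show ?thesis
  proof (intro linearI vector_space_def_scale L.vs M.vs)
    show "def_d2 L M \<phi> (u + v) = def_d2 L M \<phi> u + def_d2 L M \<phi> v" for u v
    proof -
      obtain \<mu> \<omega> \<nu> \<epsilon> \<theta> \<mu>' \<omega>' \<nu>' \<epsilon>' \<theta>' where "u = ((\<mu>, \<omega>), (\<nu>, \<epsilon>), \<theta>)" "v = ((\<mu>', \<omega>'), (\<nu>', \<epsilon>'), \<theta>')"
        by (metis prod.exhaust)
      thus ?thesis
        by (simp add: def_d2_def L.cochain_add M.cochain_add)
          (simp add: fun_eq_iff def_alpha_def def_beta_def \<phi>_simps LM.cochain_add linear_add[OF LM.act_power_linear])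
    qed
    show "def_d2 L M \<phi> (def_scale2 L M c u) = def_scale3 L M c (def_d2 L M \<phi> u)" for c u
    proof -
      obtain \<mu> \<omega> \<nu> \<epsilon> \<theta> where "u = ((\<mu>, \<omega>), (\<nu>, \<epsilon>), \<theta>)"
        by (metis prod.exhaust)
      thus ?thesis
        by (simp add: def_d2_def def_scale2_def def_scale3_def L.cochain_scale M.cochain_scale)
          (simp add: def_alpha_def def_beta_def \<phi>_simps LM.cochain_scale linear_scale[OF LM.act_power_linear]
            M'.scale_right_diff_distrib M'.scale_right_distrib)
    qed
  qed
qed

section \<open>Cochain spaces of the morphism and the composite differential\<close>

lemma def_C1_subspace: "module.subspace (def_scale1 L M) (def_C1 L M)"
proof -
  interpret vector_space "def_scale1 L M" by (rule vector_space_def_scale[OF L.vs M.vs])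
  show ?thesis
    unfolding subspace_def
    by (auto simp: def_C1_def Cst1_def Cst0_def zero_prod_def def_scale1_def L.CE1_closed M.CE1_closed)
qed

lemma def_C2_subspace: "module.subspace (def_scale2 L M) (def_C2 L M)"
proof -
  interpret vector_space "def_scale2 L M" by (rule vector_space_def_scale[OF L.vs M.vs])
  have "(0, 0) \<in> Cst2 L (scal L) (brk L)" "(0, 0) \<in> Cst2 M (scal M) (brk M)"
    using L.Cst2_closed(1) M.Cst2_closed(1) by (simp_all add: zero_prod_def)
  thus ?thesis
    unfolding subspace_def
    using L.Cst2_closed(2)[of "(_, _)" "(_, _)"] M.Cst2_closed(2)[of "(_, _)" "(_, _)"]
    by (auto simp: def_C2_def Cst1_def zero_prod_def def_scale2_def L.Cst2_closed(3) M.Cst2_closed(3) LM.CE1_closed)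
qed

lemma def_d1_C2:
  assumes "c \<in> def_C1 L M"
  shows "def_d1 L M \<phi> c \<in> def_C2 L M"
proof -
  interpret M': vector_space "scal M" by (fact M.vs)
  obtain \<gamma> \<tau> m where c: "c = (\<gamma>, \<tau>, m)" by (metis prod.exhaust)
  with assms have \<gamma>: "\<gamma> \<in> CE1 L (scal L)" and \<tau>: "\<tau> \<in> CE1 M (scal M)"
    by (simp_all add: def_C1_def Cst1_def)
  have \<gamma>': "Vector_Spaces.linear (scal L) (scal L) \<gamma>" and \<tau>': "Vector_Spaces.linear (scal M) (scal M) \<tau>"
    using \<gamma> \<tau> by (simp_all add: CE1_def)
  have "(\<lambda>x. \<phi> (\<gamma> x) - \<tau> (\<phi> x) - dCE0 (pullback_act M \<phi>) m x) \<in> CE1 L (scal M)"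
    by (auto simp: CE1_def dCE0_def \<phi>_simps linear_add[OF \<gamma>'] linear_scale[OF \<gamma>'] linear_add[OF \<tau>'] linear_scale[OF \<tau>']
        LM.act_simps M'.scale_right_diff_distrib intro!: linearI L.vs M.vs)
  thus ?thesis
    by (simp add: c def_d1_def def_C2_def Cst2_def Cst1_def L.dCE1_CE2[OF \<gamma>] M.dCE1_CE2[OF \<tau>]
        L.ind1_star[OF \<gamma>'] M.ind1_star[OF \<tau>'])
qed

lemma def_d2_C3:
  assumes "c \<in> def_C2 L M"
  shows "def_d2 L M \<phi> c \<in> def_C3 L M"
proof -
  interpret M': vector_space "scal M" by (fact M.vs)
  obtain \<mu> \<omega> \<nu> \<epsilon> \<theta> where c: "c = ((\<mu>, \<omega>), (\<nu>, \<epsilon>), \<theta>)" by (metis prod.exhaust)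
  with assms have \<mu>: "\<mu> \<in> CE2 L (scal L)" and \<omega>: "star_property L (scal L) (brk L) \<mu> \<omega>"
    and \<nu>: "\<nu> \<in> CE2 M (scal M)" and \<epsilon>: "star_property M (scal M) (brk M) \<nu> \<epsilon>"
    and \<theta>: "\<theta> \<in> CE1 L (scal M)"
    by (simp_all add: def_C2_def Cst2_def Cst1_def)
  note \<mu>' = L.CE2_linear[OF \<mu>] and \<nu>' = M.CE2_linear[OF \<nu>] and d\<theta> = LM.CE2_linear[OF LM.dCE1_CE2[OF \<theta>]]
  have \<theta>': "Vector_Spaces.linear (scal L) (scal M) \<theta>" using \<theta> by (simp add: CE1_def)
  have "def_alpha L M \<phi> \<mu> \<nu> \<theta> \<in> CE2 L (scal M)"
    by (auto simp: CE2_def def_alpha_def \<phi>_simps \<mu>'(3) \<nu>'(3) d\<theta>(3) linear_zero[OF \<phi>_linear]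
        linear_add[OF \<mu>'(1)] linear_add[OF \<mu>'(2)] linear_scale[OF \<mu>'(1)] linear_scale[OF \<mu>'(2)]
        linear_add[OF \<nu>'(1)] linear_add[OF \<nu>'(2)] linear_scale[OF \<nu>'(1)] linear_scale[OF \<nu>'(2)]
        linear_add[OF d\<theta>(1)] linear_add[OF d\<theta>(2)] linear_scale[OF d\<theta>(1)] linear_scale[OF d\<theta>(2)]
        M'.scale_right_diff_distrib intro!: linearI L.vs M.vs)
  moreover have "def_beta L M \<phi> \<omega> \<epsilon> \<theta> (scal L k x) = scal M (k ^ CHAR('f)) (def_beta L M \<phi> \<omega> \<epsilon> \<theta> x)" for k x
  proof -
    have "\<omega> (scal L k x) = scal L (k ^ CHAR('f)) (\<omega> x)" "\<epsilon> (scal M k y) = scal M (k ^ CHAR('f)) (\<epsilon> y)" for y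
      using \<omega> \<epsilon> by (auto simp: star_property_def)
    \<comment> \<open>The action contributes \<open>p - 1\<close> factors \<open>k\<close> and the
      linear map \<theta> the last one.\<close>
    moreover have "k ^ (CHAR('f) - 1) * k = k ^ CHAR('f)" using char by (cases "CHAR('f)") simp_all
    ultimately show ?thesis
      by (simp add: def_beta_def L.pmap_scale \<phi>_simps linear_scale[OF \<theta>'] LM.act_power_scale linear_scale[OF LM.act_power_linear]
          M'.scale_right_diff_distrib M'.scale_right_distrib mult.commute)
  qed
  ultimately show ?thesis
    by (simp add: c def_d2_def def_C3_def Cst3_def Cst2_tilde_def L.dCE2_CE3[OF \<mu>] M.dCE2_CE3[OF \<nu>]
        L.ind2_star_star[OF \<mu> \<omega>] M.ind2_star_star[OF \<nu> \<epsilon>])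
qed

lemma def_d2_def_d1:
  assumes "c \<in> def_C1 L M"
  shows "def_d2 L M \<phi> (def_d1 L M \<phi> c) = 0"
proof -
  obtain \<gamma> \<tau> m where c: "c = (\<gamma>, \<tau>, m)" by (metis prod.exhaust)
  with assms have \<gamma>: "\<gamma> \<in> CE1 L (scal L)" and \<tau>: "\<tau> \<in> CE1 M (scal M)"
    by (simp_all add: def_C1_def Cst1_def)
  let ?\<theta> = "\<lambda>x. \<phi> (\<gamma> x) - \<tau> (\<phi> x) - dCE0 (pullback_act M \<phi>) m x"
  obtain n where p: "CHAR('f) = Suc n" using L.char_eq by blast
  \<comment> \<open>Since \<phi> respects brackets, the coboundary of \<phi>\<circ>\<gamma> is
    \<phi> after that of \<gamma>, and that of \<tau>\<circ>\<phi> is that of \<tau> on images under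
    \<phi>. The part from \<open>m\<close> is a twofold coboundary, 0 by
    \<open>M.act_brk\<close>.\<close>
  have "def_alpha L M \<phi> (dCE1 L (brk L) \<gamma>) (dCE1 M (brk M) \<tau>) ?\<theta> x y = 0" for x y
    by (simp add: def_alpha_def dCE1_def dCE0_def pullback_act_eq \<phi>_simps M.act_simps M.act_brk)
  moreover have "def_beta L M \<phi> (ind1 L (brk L) \<gamma>) (ind1 M (brk M) \<tau>) ?\<theta> x = 0" for x
  proof -
    \<comment> \<open>This matches the two contributions of \<open>m\<close>, one through \<theta>
      at the p-map of \<open>x\<close> and one through \<open>x\<close> acting p - 1 times on
      \<theta>(x); they have opposite signs.\<close>
    have "(brk M (\<phi> x) ^^ (CHAR('f) - 1)) (brk M (\<phi> x) m) = brk M (pmap M (\<phi> x)) m"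
      by (simp add: M.act_pmap p funpow_swap1)
    thus ?thesis
      by (simp add: def_beta_def ind1_def dCE0_def pullback_act_eq \<phi>_simps \<phi>_brk_power linear_diff[OF M.act_power_linear])
  qed
  ultimately show ?thesis
    by (simp add: c def_d1_def def_d2_def L.dCE2_dCE1[OF \<gamma>] M.dCE2_dCE1[OF \<tau>] L.ind2_dCE1[OF \<gamma>] M.ind2_dCE1[OF \<tau>]
        zero_prod_def fun_eq_iff)
qed

lemma quotient_well_defined_1: "quotient_well_defined (def_scale1 L M) (def_Z1 L M \<phi>) (def_B1 L M)"
proof -
  interpret d1: Vector_Spaces.linear "def_scale1 L M" "def_scale2 L M" "def_d1 L M \<phi>" by (rule def_d1_linear)
  have Z1: "def_Z1 L M \<phi> = def_C1 L M \<inter> {c. def_d1 L M \<phi> c = 0}" and B1: "def_B1 L M = {0}"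
    by (auto simp: def_Z1_def def_B1_def def_C0_def def_d0_def)
  show ?thesis
    unfolding Z1 B1 using d1.vs1.subspace_0[OF def_C1_subspace]
    by (intro quotient_well_definedI d1.vs1.vector_space_axioms d1.vs1.subspace_inter def_C1_subspace d1.subspace_kernel)
      (simp_all add: d1.zero)
qed

lemma quotient_well_defined_2: "quotient_well_defined (def_scale2 L M) (def_Z2 L M \<phi>) (def_B2 L M \<phi>)"
proof -
  interpret V2: vector_space "def_scale2 L M" by (rule vector_space_def_scale(2)[OF L.vs M.vs])
  interpret d1: Vector_Spaces.linear "def_scale1 L M" "def_scale2 L M" "def_d1 L M \<phi>" by (rule def_d1_linear)
  interpret d2: Vector_Spaces.linear "def_scale2 L M" "def_scale3 L M" "def_d2 L M \<phi>" by (rule def_d2_linear)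
  have Z2: "def_Z2 L M \<phi> = def_C2 L M \<inter> {c. def_d2 L M \<phi> c = 0}"
    by (auto simp: def_Z2_def)
  show ?thesis
    unfolding Z2 def_B2_def
    by (intro quotient_well_definedI V2.vector_space_axioms V2.subspace_inter def_C2_subspace d2.subspace_kernel
        d1.subspace_image def_C1_subspace)
      (auto simp: def_d1_C2 def_d2_def_d1)
qed

end

theorem proposition3p12:
  fixes L :: "('f::field, 'a::ab_group_add) restricted_lie"
    and M :: "('f, 'b::ab_group_add) restricted_lie"
    and \<phi> :: "'a \<Rightarrow> 'b"
  assumes "CHAR('f) \<ge> 3"
    and "restricted_lie_algebra L"
    and "restricted_lie_algebra M"
    and "restricted_morphism L M \<phi>"
  shows "def_d0 L M \<in> def_C0 L M \<rightarrow> def_C1 L M \<and>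
    def_d1 L M \<phi> \<in> def_C1 L M \<rightarrow> def_C2 L M \<and>
    def_d2 L M \<phi> \<in> def_C2 L M \<rightarrow> def_C3 L M \<and>
    (\<forall>c \<in> def_C1 L M. def_d2 L M \<phi> (def_d1 L M \<phi> c) = 0) \<and>
    (\<forall>c \<in> def_C0 L M. def_d1 L M \<phi> (def_d0 L M c) = 0) \<and>
    quotient_well_defined (def_scale1 L M) (def_Z1 L M \<phi>) (def_B1 L M) \<and>
    quotient_well_defined (def_scale2 L M) (def_Z2 L M \<phi>) (def_B2 L M \<phi>)"
proof -
  interpret def_complex L M \<phi> by (rule def_complex.intro) fact+
  interpret d1: Vector_Spaces.linear "def_scale1 L M" "def_scale2 L M" "def_d1 L M \<phi>" by (rule def_d1_linear)
  show ?thesis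
    using d1.vs1.subspace_0[OF def_C1_subspace]
    by (auto simp: def_d0_def d1.zero def_d1_C2 def_d2_C3 def_d2_def_d1 quotient_well_defined_1 quotient_well_defined_2)
qed

end
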